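(* Let $P(\lambda)=\ell(\lambda)\sum_{i=1}^{k+1}P_i\frac{w_i}{\gamma_i(\lambda)}$, $P_i\in\mathbb{C}^{n\times n}$, be a regular matrix polynomial expressed in the modified Lagrange basis associated with nodes $\{x_1,\ldots,x_{k+1}\}$, and let $\lambda_0$ be a finite eigenvalue of $P(\lambda)$. Let $0\le\mu\le k-1$ be an integer, and let $L_P^\mu(\lambda)=\begin{bmatrix}M_\mu^L(\lambda)&K_2^L(\lambda)^T\\ K_1^L(\lambda)&0\end{bmatrix}$. Then $z$ (resp. $w$) is a right (resp. left) eigenvector of $L_P^\mu(\lambda)$ associated with $\lambda_0$ if and only if $z=H_L^\mu(\lambda_0)x$ (resp. $w=G_L^\mu(\lambda_0)^Ty$), where $x$ (resp. $y$) is a right (resp. left) eigenvector of $P(\lambda)$ associated with $\lambda_0$.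
   Context: Lagrange setting (here $m=n$). Let $k\ge1$ and let $x_1,\ldots,x_{k+1}\in\mathbb{C}$ be distinct nodes. Put $\gamma_i(\lambda)=\lambda-x_i$, $\ell(\lambda)=\prod_{i=1}^{k+1}(\lambda-x_i)$, $w_i=1/\prod_{j\ne i}(x_i-x_j)$, and $n_i^j(\lambda)=\prod_{t=i}^j\gamma_t(\lambda)$ if $j\ge i$, $n_i^j=1$ if $j<i$. For $0\le\mu\le k-1$, $$K_1^L(\lambda)=\begin{bmatrix}\gamma_{k+1}I_n&-\gamma_{k-1}I_n\\&\gamma_kI_n&-\gamma_{k-2}I_n\\&&\ddots&\ddots\\&&&\gamma_{\mu+3}I_n&-\gamma_{\mu+1}I_n\end{bmatrix},\quad K_2^L(\lambda)=\begin{bmatrix}\gamma_{\mu+2}I_n&-\gamma_{\mu}I_n\\&\gamma_{\mu+1}I_n&-\gamma_{\mu-1}I_n\\&&\ddots&\ddots\\&&&\gamma_3I_n&-\gamma_1I_n\end{bmatrix},$$ of sizes $(k-\mu-1)n\times(k-\mu)n$ and $\mu n\times(\mu+1)n$ ($K_1^L$ is empty if $\mu=k-1$, $K_2^L$ is empty if $\mu=0$). $M_\mu^L(\lambda)$ is the $(\mu+1)\times(k-\mu)$ block pencil with $n\times n$ blocks: if $\mu<k-1$, its first block row is $[P_{k+1}w_{k+1}\gamma_k+P_kw_k\gamma_{k+1},\ P_{k-1}w_{k-1}\gamma_k,\ldots,P_{\mu+1}w_{\mu+1}\gamma_{\mu+2}]$, its last block column has, from top to bottom, blocks $P_{\mu+1}w_{\mu+1}\gamma_{\mu+2},P_\mu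 w_\mu\gamma_{\mu+1},\ldots,P_2w_2\gamma_3,P_1w_1\gamma_2$, and all other blocks are $0$; if $\mu=k-1$, it is the block column with blocks $P_{k+1}w_{k+1}\gamma_k+P_kw_k\gamma_{k+1},\ P_{k-1}w_{k-1}\gamma_k,\ldots,P_2w_2\gamma_3,P_1w_1\gamma_2$. Let $D_1^L(\lambda)$ be the block row with the $k-\mu$ blocks $\frac{n_{\mu+1}^{k+1}(\lambda)}{\gamma_{j+1}(\lambda)\gamma_j(\lambda)}I_n$, $j=k,k-1,\ldots,\mu+1$ (in this order), and $D_2^L(\lambda)$ the block row with the $\mu+1$ blocks $\frac{n_1^{\mu+2}(\lambda)}{\gamma_{j+1}(\lambda)\gamma_j(\lambda)}I_n$, $j=\mu+1,\mu,\ldots,1$ (in this order). Let $a_1,\ldots,a_{\mu+1}$ be the unique scalars with $\sum_{i=1}^{\mu+1}a_i\frac{n_1^{\mu+2}(\lambda)}{\gamma_{i+1}(\lambda)\gamma_i(\lambda)}=1$ and $b_{\mu+1},\ldots,b_k$ the unique scalars with $\sum_{i=\mu+1}^kb_i\frac{n_{\mu+1}^{k+1}(\lambda)}{\gamma_{i+1}(\lambda)\gamma_i(\lambda)}=1$. Put $T_j^P(\lambda)=\ell(\lambda)\sum_{i=1}^jP_i\frac{w_i}{\gamma_i(\lambda)}$ and $S_j^P(\lambda)=\ell(\lambda)\sum_{i=j}^{k+1}P_i\frac{w_i}{\gamma_i(\lambda)}$ for $j=1,\ldots,k+1$, and $$\mathcal{P}_j^\mu(\lambda)=-\sum_{i=1}^ja_i\frac{\gamma_{j+1}}{\gamma_i\gamma_{i+1}}S_{j+1}^P+\sum_{i=j+1}^{\mu+1}a_i\frac{\gamma_{j+1}}{\gamma_i\gamma_{i+1}}T_j^P\quad(1\le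 j\le\mu),$$ $$\mathcal{Q}_j^\mu(\lambda)=-\sum_{i=\mu+1}^jb_i\frac{\gamma_{j+1}}{\gamma_i\gamma_{i+1}}S_{j+1}^P+\sum_{i=j+1}^{k}b_i\frac{\gamma_{j+1}}{\gamma_i\gamma_{i+1}}T_j^P\quad(\mu+1\le j\le k-1);$$ these rational expressions are matrix polynomials and are evaluated as such. $H_L^\mu(\lambda)$ is the block column obtained by stacking $D_1^L(\lambda)^T$ on top of $\mathcal{P}_\mu^\mu(\lambda),\mathcal{P}_{\mu-1}^\mu(\lambda),\ldots,\mathcal{P}_1^\mu(\lambda)$ (just $D_1^L(\lambda)^T$ if $\mu=0$). $G_L^\mu(\lambda)$ is the block row $[D_2^L(\lambda),\mathcal{Q}_{k-1}^\mu(\lambda),\ldots,\mathcal{Q}_{\mu+1}^\mu(\lambda)]$ (just $D_2^L(\lambda)$ if $\mu=k-1$). A square matrix polynomial is regular if its determinant is not identically zero. $\lambda_0\in\mathbb{C}$ is a finite eigenvalue of $P$ if $P(\lambda_0)$ is singular; a right (left) eigenvector is a nonzero $x$ with $P(\lambda_0)x=0$ (nonzero $y$ with $y^TP(\lambda_0)=0$, plain transpose); the same for pencils. *)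

theory Defs
  imports
    "HOL-Library.FuncSet"
    "HOL-Computational_Algebra.Computational_Algebra"
    "Jordan_Normal_Form.Matrix"
    "Jordan_Normal_Form.Determinant"
begin

section \<open>Matrix polynomials\<close>

text \<open>Matrix polynomials are matrices over \<^typ>\<open>complex poly\<close>.\<close>

definition eval_mat :: "complex poly mat \<Rightarrow> complex \<Rightarrow> complex mat" where
  "eval_mat A z = map_mat (\<lambda>p. poly p z) A"

definition const_mat :: "complex mat \<Rightarrow> complex poly mat" where
  "const_mat A = map_mat (\<lambda>c. [:c:]) A"

definition regular_mat_poly :: "complex poly mat \<Rightarrow> bool" where
  "regular_mat_poly A \<longleftrightarrow> square_mat A \<and> det A \<noteq> 0"

definition finite_eigenvalue :: "complex poly mat \<Rightarrow> complex \<Rightarrow> bool" where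
  "finite_eigenvalue A z \<longleftrightarrow> square_mat A \<and> \<not> invertible_mat (eval_mat A z)"

definition right_eigenvector :: "complex poly mat \<Rightarrow> complex \<Rightarrow> complex vec \<Rightarrow> bool" where
  "right_eigenvector A z u \<longleftrightarrow>
     u \<in> carrier_vec (dim_col A) \<and> u \<noteq> 0\<^sub>v (dim_col A) \<and>
     eval_mat A z *\<^sub>v u = 0\<^sub>v (dim_row A)"

text \<open>Plain transpose, no conjugation: the row vector is \<^term>\<open>mat_of_row v\<close>.\<close>

definition left_eigenvector :: "complex poly mat \<Rightarrow> complex \<Rightarrow> complex vec \<Rightarrow> bool" where
  "left_eigenvector A z v \<longleftrightarrow>
     v \<in> carrier_vec (dim_row A) \<and> v \<noteq> 0\<^sub>v (dim_row A) \<and>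
     mat_of_row v * eval_mat A z = 0\<^sub>m 1 (dim_col A)"

text \<open>\<open>block_mat n R C f\<close> has \<open>R\<close> block rows and \<open>C\<close> block columns; its \<open>n \<times> n\<close> block in
  position \<open>(r, c)\<close> (counted from \<open>0\<close>) is \<open>f r c\<close>.\<close>

definition block_mat :: "nat \<Rightarrow> nat \<Rightarrow> nat \<Rightarrow> (nat \<Rightarrow> nat \<Rightarrow> 'a mat) \<Rightarrow> 'a mat" where
  "block_mat n R C f =
     mat (R * n) (C * n) (\<lambda>(i, j). f (i div n) (j div n) $$ (i mod n, j mod n))"


section \<open>The modified Lagrange basis\<close>

text \<open>Nodes \<open>x\<close> and matrix coefficients \<open>P\<close> are indexed by \<open>{1..k+1}\<close>. Every \<open>div\<close> below is
  an exact division of polynomials when the nodes are distinct: it stands for a rational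
  expression which is a polynomial.\<close>

definition gam :: "(nat \<Rightarrow> complex) \<Rightarrow> nat \<Rightarrow> complex poly" where
  "gam x i = [:- x i, 1:]"

definition ell :: "nat \<Rightarrow> (nat \<Rightarrow> complex) \<Rightarrow> complex poly" where
  "ell k x = (\<Prod>i=1..k+1. gam x i)"

definition wt :: "nat \<Rightarrow> (nat \<Rightarrow> complex) \<Rightarrow> nat \<Rightarrow> complex" where
  "wt k x i = 1 / (\<Prod>j\<in>{1..k+1} - {i}. x i - x j)"

definition gam_prod :: "(nat \<Rightarrow> complex) \<Rightarrow> nat \<Rightarrow> nat \<Rightarrow> complex poly" where
  "gam_prod x i j = (\<Prod>t=i..j. gam x t)"

definition lagrange_sum ::
  "nat \<Rightarrow> nat \<Rightarrow> (nat \<Rightarrow> complex) \<Rightarrow> (nat \<Rightarrow> complex mat) \<Rightarrow> nat set \<Rightarrow> complex poly mat" where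
  "lagrange_sum n k x P I =
     mat n n (\<lambda>(r, s). \<Sum>i\<in>I. Polynomial.smult (P i $$ (r, s) * wt k x i) (ell k x div gam x i))"

definition lagrange_poly ::
  "nat \<Rightarrow> nat \<Rightarrow> (nat \<Rightarrow> complex) \<Rightarrow> (nat \<Rightarrow> complex mat) \<Rightarrow> complex poly mat" where
  "lagrange_poly n k x P = lagrange_sum n k x P {1..k+1}"

definition T_poly ::
  "nat \<Rightarrow> nat \<Rightarrow> (nat \<Rightarrow> complex) \<Rightarrow> (nat \<Rightarrow> complex mat) \<Rightarrow> nat \<Rightarrow> complex poly mat" where
  "T_poly n k x P j = lagrange_sum n k x P {1..j}"

definition S_poly ::
  "nat \<Rightarrow> nat \<Rightarrow> (nat \<Rightarrow> complex) \<Rightarrow> (nat \<Rightarrow> complex mat) \<Rightarrow> nat \<Rightarrow> complex poly mat" where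
  "S_poly n k x P j = lagrange_sum n k x P {j..k+1}"


section \<open>The linearization\<close>

definition K1 :: "nat \<Rightarrow> nat \<Rightarrow> nat \<Rightarrow> (nat \<Rightarrow> complex) \<Rightarrow> complex poly mat" where
  "K1 n k \<mu> x = block_mat n (k - \<mu> - 1) (k - \<mu>) (\<lambda>r c.
     if c = r then gam x (k + 1 - r) \<cdot>\<^sub>m 1\<^sub>m n
     else if c = r + 1 then (- gam x (k - 1 - r)) \<cdot>\<^sub>m 1\<^sub>m n
     else 0\<^sub>m n n)"

definition K2 :: "nat \<Rightarrow> nat \<Rightarrow> (nat \<Rightarrow> complex) \<Rightarrow> complex poly mat" where
  "K2 n \<mu> x = block_mat n \<mu> (\<mu> + 1) (\<lambda>r c.
     if c = r then gam x (\<mu> + 2 - r) \<cdot>\<^sub>m 1\<^sub>m n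
     else if c = r + 1 then (- gam x (\<mu> - r)) \<cdot>\<^sub>m 1\<^sub>m n
     else 0\<^sub>m n n)"

text \<open>For \<open>\<mu> = k - 1\<close> there is a single block column, and \<open>\<mu> + 1 - r = k - r\<close>. For
  \<open>\<mu> < k - 1\<close>, the block in the corner of the first row and the last column is the one with
  index \<open>\<mu> + 1\<close> by either description.\<close>

definition M_pencil ::
  "nat \<Rightarrow> nat \<Rightarrow> nat \<Rightarrow> (nat \<Rightarrow> complex) \<Rightarrow> (nat \<Rightarrow> complex mat) \<Rightarrow> complex poly mat" where
  "M_pencil n k \<mu> x P = block_mat n (\<mu> + 1) (k - \<mu>) (\<lambda>r c.
     let B = (\<lambda>i g. Polynomial.smult (wt k x i) (gam x g) \<cdot>\<^sub>m const_mat (P i)) in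
     if r = 0 \<and> c = 0 then B (k + 1) k + B k (k + 1)
     else if r = 0 then B (k - c) (k - c + 1)
     else if c = k - \<mu> - 1 then B (\<mu> + 1 - r) (\<mu> + 2 - r)
     else 0\<^sub>m n n)"

definition L_pencil ::
  "nat \<Rightarrow> nat \<Rightarrow> nat \<Rightarrow> (nat \<Rightarrow> complex) \<Rightarrow> (nat \<Rightarrow> complex mat) \<Rightarrow> complex poly mat" where
  "L_pencil n k \<mu> x P =
     four_block_mat (M_pencil n k \<mu> x P) (transpose_mat (K2 n \<mu> x))
                    (K1 n k \<mu> x) (0\<^sub>m ((k - \<mu> - 1) * n) (\<mu> * n))"


section \<open>Recovery of eigenvectors\<close>

text \<open>The two dual bases, the two families of scalars and the two families of matrix polynomials
  have the same form; they use the index ranges \<open>lo..hi = 1..\<mu>+1\<close> and \<open>lo..hi = \<mu>+1..k\<close>.\<close>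

definition dual_fac :: "(nat \<Rightarrow> complex) \<Rightarrow> nat \<Rightarrow> nat \<Rightarrow> nat \<Rightarrow> complex poly" where
  "dual_fac x lo hi j = gam_prod x lo (hi + 1) div (gam x (j + 1) * gam x j)"

text \<open>The scalars are unique as a family indexed by \<open>{lo..hi}\<close>; extensionality fixes the
  irrelevant values outside this range.\<close>

definition dual_coeff :: "(nat \<Rightarrow> complex) \<Rightarrow> nat \<Rightarrow> nat \<Rightarrow> nat \<Rightarrow> complex" where
  "dual_coeff x lo hi =
     (THE a. a \<in> extensional {lo..hi} \<and>
        (\<Sum>i=lo..hi. Polynomial.smult (a i) (dual_fac x lo hi i)) = 1)"

definition a_coeff :: "nat \<Rightarrow> (nat \<Rightarrow> complex) \<Rightarrow> nat \<Rightarrow> complex" where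
  "a_coeff \<mu> x = dual_coeff x 1 (\<mu> + 1)"

definition b_coeff :: "nat \<Rightarrow> nat \<Rightarrow> (nat \<Rightarrow> complex) \<Rightarrow> nat \<Rightarrow> complex" where
  "b_coeff k \<mu> x = dual_coeff x (\<mu> + 1) k"

definition D1 :: "nat \<Rightarrow> nat \<Rightarrow> nat \<Rightarrow> (nat \<Rightarrow> complex) \<Rightarrow> complex poly mat" where
  "D1 n k \<mu> x = block_mat n 1 (k - \<mu>) (\<lambda>_ c. dual_fac x (\<mu> + 1) k (k - c) \<cdot>\<^sub>m 1\<^sub>m n)"

definition D2 :: "nat \<Rightarrow> nat \<Rightarrow> (nat \<Rightarrow> complex) \<Rightarrow> complex poly mat" where
  "D2 n \<mu> x = block_mat n 1 (\<mu> + 1) (\<lambda>_ c. dual_fac x 1 (\<mu> + 1) (\<mu> + 1 - c) \<cdot>\<^sub>m 1\<^sub>m n)"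

definition aux_poly ::
  "nat \<Rightarrow> nat \<Rightarrow> (nat \<Rightarrow> complex) \<Rightarrow> (nat \<Rightarrow> complex mat) \<Rightarrow> (nat \<Rightarrow> complex) \<Rightarrow>
   nat \<Rightarrow> nat \<Rightarrow> nat \<Rightarrow> complex poly mat" where
  "aux_poly n k x P a lo hi j = mat n n (\<lambda>(r, s).
     - (\<Sum>i=lo..j. Polynomial.smult (a i)
          ((gam x (j + 1) * S_poly n k x P (j + 1) $$ (r, s)) div (gam x i * gam x (i + 1))))
     + (\<Sum>i=j+1..hi. Polynomial.smult (a i)
          ((gam x (j + 1) * T_poly n k x P j $$ (r, s)) div (gam x i * gam x (i + 1)))))"

definition P_aux ::
  "nat \<Rightarrow> nat \<Rightarrow> nat \<Rightarrow> (nat \<Rightarrow> complex) \<Rightarrow> (nat \<Rightarrow> complex mat) \<Rightarrow> nat \<Rightarrow> complex poly mat" where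
  "P_aux n k \<mu> x P j = aux_poly n k x P (a_coeff \<mu> x) 1 (\<mu> + 1) j"

definition Q_aux ::
  "nat \<Rightarrow> nat \<Rightarrow> nat \<Rightarrow> (nat \<Rightarrow> complex) \<Rightarrow> (nat \<Rightarrow> complex mat) \<Rightarrow> nat \<Rightarrow> complex poly mat" where
  "Q_aux n k \<mu> x P j = aux_poly n k x P (b_coeff k \<mu> x) (\<mu> + 1) k j"

definition H_mat ::
  "nat \<Rightarrow> nat \<Rightarrow> nat \<Rightarrow> (nat \<Rightarrow> complex) \<Rightarrow> (nat \<Rightarrow> complex mat) \<Rightarrow> complex poly mat" where
  "H_mat n k \<mu> x P =
     transpose_mat (D1 n k \<mu> x) @\<^sub>r block_mat n \<mu> 1 (\<lambda>r _. P_aux n k \<mu> x P (\<mu> - r))"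

text \<open>The lower two blocks have no rows, so this is the concatenation of two block rows.\<close>

definition G_mat ::
  "nat \<Rightarrow> nat \<Rightarrow> nat \<Rightarrow> (nat \<Rightarrow> complex) \<Rightarrow> (nat \<Rightarrow> complex mat) \<Rightarrow> complex poly mat" where
  "G_mat n k \<mu> x P =
     four_block_mat (D2 n \<mu> x)
                    (block_mat n 1 (k - \<mu> - 1) (\<lambda>_ c. Q_aux n k \<mu> x P (k - 1 - c)))
                    (0\<^sub>m 0 ((\<mu> + 1) * n)) (0\<^sub>m 0 ((k - \<mu> - 1) * n))"

end

(* The block rows D of the paper span the kernels of the bidiagonal pencils K: a solution of the
   three-term relation g(j+2) v(j+1) = g(j) v(j), with g(j) = z - x(j), is a multiple of the dual
   basis, because distinct nodes never make both factors vanish. Hence a kernel vector of L has top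
   part D1^T u. With H = [D1^T; H2] the recovery matrix, everything then rests on one identity of
   matrix polynomials,
     M D1^T + K2^T H2 = [a_(mu+1) P; ...; a_1 P],
   where the a_i are the dual coefficients. Multiplying it by D2 gives D2 M D1^T = P, since
   D2 K2^T = 0, so P u = 0; and K2^T is injective, which determines the bottom part.
   After multiplication by N = g(lo) ... g(hi+1) the identity telescopes: N times the j-th auxiliary
   polynomial is g(j+1) (T_j - A_j P), where A_j is a partial sum of sum_i a_i e_i = 1 (the e_i
   are the entries of D2).
   The left eigenvectors satisfy the same statement for the transposed pencil, with the index ranges
   1..mu+1 and mu+1..k exchanged. *)

theory Submission
  imports Defs
begin

section \<open>The dual basis\<close>

lemma gam_neq_0 [simp]: "gam x i \<noteq> 0"
  by (simp add: gam_def)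

lemma gam_prod_neq_0 [simp]: "gam_prod x i j \<noteq> 0"
  by (simp add: gam_prod_def)

lemma poly_gam [simp]: "poly (gam x i) z = z - x i"
  by (simp add: gam_def)

lemma gam_mult_dvd_prod:
  assumes "finite I" "i \<in> I" "Suc i \<in> I"
  shows "gam x i * gam x (Suc i) dvd (\<Prod>t\<in>I. gam x t)"
proof -
  have "gam x i * gam x (Suc i) = (\<Prod>t\<in>{i, Suc i}. gam x t)" by simp
  also have "\<dots> dvd (\<Prod>t\<in>I. gam x t)"
    using assms by (intro prod_dvd_prod_subset) auto
  finally show ?thesis .
qed

text \<open>The two divided factors are consecutive nodes of the range, so the division is exact.
  Identities for \<open>dual_fac\<close> are proved by multiplying with
  \<open>gam x j * gam x (Suc j)\<close> and cancelling.\<close>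

lemma dual_fac_mult:
  assumes "lo \<le> j" "j \<le> hi"
  shows "dual_fac x lo hi j * (gam x j * gam x (Suc j)) = gam_prod x lo (Suc hi)"
  using gam_mult_dvd_prod[of "{lo..Suc hi}" j x] assms
  by (simp add: dual_fac_def gam_prod_def mult.commute)

lemma gam_prod_Suc:
  "lo \<le> Suc hi \<Longrightarrow> gam_prod x lo (Suc hi) = gam_prod x lo hi * gam x (Suc hi)"
  by (simp add: gam_prod_def)

text \<open>Together with \<open>dual_fac_last\<close> this drives the inductions on
  \<open>hi\<close>: all old dual factors acquire a zero at the new node, and the new last one has
  none there when the nodes are distinct.\<close>

lemma dual_fac_Suc:
  assumes "lo \<le> j" "j \<le> hi"
  shows "dual_fac x lo (Suc hi) j = dual_fac x lo hi j * gam x (Suc (Suc hi))"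
proof -
  let ?g = "gam x j * gam x (Suc j)"
  have "dual_fac x lo (Suc hi) j * ?g = gam_prod x lo (Suc (Suc hi))"
    using assms by (simp only: dual_fac_mult)
  also have "\<dots> = gam_prod x lo (Suc hi) * gam x (Suc (Suc hi))"
    using assms by (intro gam_prod_Suc) simp
  also have "\<dots> = (dual_fac x lo hi j * gam x (Suc (Suc hi))) * ?g"
    by (simp only: dual_fac_mult[OF assms, symmetric] mult_ac)
  finally show ?thesis
    by (simp only: mult_cancel_right) simp
qed

lemma dual_fac_last:
  assumes "lo \<le> Suc hi"
  shows "dual_fac x lo (Suc hi) (Suc hi) = gam_prod x lo hi"
proof -
  let ?g = "gam x (Suc hi) * gam x (Suc (Suc hi))"
  have "dual_fac x lo (Suc hi) (Suc hi) * ?g = gam_prod x lo (Suc (Suc hi))"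
    using assms by (simp only: dual_fac_mult)
  also have "\<dots> = gam_prod x lo hi * ?g"
    using assms by (simp add: gam_prod_Suc mult_ac)
  finally show ?thesis
    by (simp only: mult_cancel_right) simp
qed

lemma dual_fac_self: "dual_fac x lo lo lo = 1"
proof -
  have "{lo..Suc lo} = {lo, Suc lo}" by auto
  then have "gam_prod x lo (Suc lo) = gam x lo * gam x (Suc lo)"
    by (simp add: gam_prod_def)
  then show ?thesis by (simp add: dual_fac_def mult.commute)
qed

section \<open>The dual factors as a basis of the polynomials of bounded degree\<close>

lemma degree_gam_prod: "degree (gam_prod x lo hi) = Suc hi - lo"
  unfolding gam_prod_def by (subst degree_prod_sum_eq) (auto simp: gam_def)

lemma poly_gam_prod_neq_0:
  assumes "inj_on x {lo..m}" "hi < m" "lo \<le> m"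
  shows "poly (gam_prod x lo hi) (x m) \<noteq> 0"
  using assms by (fastforce simp: gam_prod_def poly_prod dest: inj_onD)

text \<open>Newton-style interpolation: the coefficient of the last factor is read off at the newest
  node; the remainder vanishes there, and dividing by that linear factor reduces to the shorter
  range with the degree bound lowered by one.\<close>

lemma dual_span:
  assumes "lo \<le> hi" "inj_on x {lo..Suc hi}" "degree q \<le> hi - lo"
  shows "\<exists>a. (\<Sum>i=lo..hi. Polynomial.smult (a i) (dual_fac x lo hi i)) = q"
  using assms
proof (induction hi arbitrary: q rule: dec_induct)
  case base
  then obtain c where "q = [:c:]" by (auto elim: degree_eq_zeroE)
  then show ?case by (intro exI[of _ "\<lambda>_. c"]) (simp add: dual_fac_self)
next
  case (step hi)
  let ?m = "Suc (Suc hi)"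
  have nz: "poly (gam_prod x lo hi) (x ?m) \<noteq> 0"
    using step by (intro poly_gam_prod_neq_0) auto
  \<comment> \<open>At \<open>x ?m\<close> every dual factor of the enlarged range except the last
    one vanishes, so this value of the last coefficient is forced.\<close>
  define c where "c = poly q (x ?m) / poly (gam_prod x lo hi) (x ?m)"
  define r where "r = q - Polynomial.smult c (gam_prod x lo hi)"
  have "poly r (x ?m) = 0" using nz by (simp add: r_def c_def)
  then obtain s where s: "r = gam x ?m * s"
    by (metis poly_eq_0_iff_dvd gam_def dvdE)
  have dr: "degree r \<le> Suc hi - lo"
    unfolding r_def using step.prems(2) 
    by (intro degree_diff_le) (auto intro: order_trans[OF degree_smult_le] simp: degree_gam_prod)
  have "degree s \<le> hi - lo"
  proof (cases "s = 0")
    case False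
    then have "degree r = Suc (degree s)"
      unfolding s by (subst degree_mult_eq) (simp_all add: gam_def)
    then show ?thesis using dr by linarith
  qed simp
  moreover have "inj_on x {lo..Suc hi}"
    using step.prems(1) by (rule inj_on_subset) auto
  ultimately obtain a where a: "(\<Sum>i=lo..hi. Polynomial.smult (a i) (dual_fac x lo hi i)) = s"
    using step.IH by blast
  have "(\<Sum>i=lo..Suc hi. Polynomial.smult ((a(Suc hi := c)) i) (dual_fac x lo (Suc hi) i)) =
      (\<Sum>i=lo..hi. Polynomial.smult (a i) (dual_fac x lo hi i * gam x ?m)) +
      Polynomial.smult c (gam_prod x lo hi)"
    using step.hyps by (simp add: dual_fac_Suc dual_fac_last)
  also have "(\<Sum>i=lo..hi. Polynomial.smult (a i) (dual_fac x lo hi i * gam x ?m)) =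
      (\<Sum>i=lo..hi. Polynomial.smult (a i) (dual_fac x lo hi i)) * gam x ?m"
    by (simp add: sum_distrib_right)
  also have "\<dots> = r" by (simp add: a s mult.commute)
  finally show ?case unfolding r_def by (metis diff_add_cancel)
qed

text \<open>Evaluation at the newest node isolates the last coefficient; cancelling the linear
  factor of that node leaves the relation for the shorter range.\<close>

lemma dual_independent:
  assumes "lo \<le> hi" "inj_on x {lo..Suc hi}"
    "(\<Sum>i=lo..hi. Polynomial.smult (a i) (dual_fac x lo hi i)) = 0"
  shows "\<forall>i\<in>{lo..hi}. a i = 0"
  using assms
proof (induction hi rule: dec_induct)
  case base
  then show ?case by (simp add: dual_fac_self)
next
  case (step hi)
  let ?m = "Suc (Suc hi)"
  let ?S = "\<Sum>i=lo..hi. Polynomial.smult (a i) (dual_fac x lo hi i)"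
  have nz: "poly (gam_prod x lo hi) (x ?m) \<noteq> 0"
    using step by (intro poly_gam_prod_neq_0) auto
  have "(\<Sum>i=lo..Suc hi. Polynomial.smult (a i) (dual_fac x lo (Suc hi) i)) =
      (\<Sum>i=lo..hi. Polynomial.smult (a i) (dual_fac x lo hi i * gam x ?m)) +
      Polynomial.smult (a (Suc hi)) (gam_prod x lo hi)"
    using step.hyps by (simp add: dual_fac_Suc dual_fac_last)
  also have "(\<Sum>i=lo..hi. Polynomial.smult (a i) (dual_fac x lo hi i * gam x ?m)) = ?S * gam x ?m"
    by (simp add: sum_distrib_right)
  finally have *: "?S * gam x ?m + Polynomial.smult (a (Suc hi)) (gam_prod x lo hi) = 0"
    using step.prems by simp
  from arg_cong[OF this, of "\<lambda>p. poly p (x ?m)"] have last: "a (Suc hi) = 0"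
    using nz by simp
  with * have "?S = 0" by simp
  moreover have "inj_on x {lo..Suc hi}"
    using step.prems(1) by (rule inj_on_subset) auto
  ultimately show ?case using step.IH last by (auto simp: le_Suc_eq)
qed

text \<open>The definite description is meaningful: spanning, applied to the constant 1, gives
  existence, and independence gives uniqueness on \<open>{lo..hi}\<close>. Restriction only provides
  the required extensionality.\<close>

lemma dual_coeff_sum:
  assumes "lo \<le> hi" "inj_on x {lo..Suc hi}"
  shows "(\<Sum>i=lo..hi. Polynomial.smult (dual_coeff x lo hi i) (dual_fac x lo hi i)) = 1"
proof -
  let ?P = "\<lambda>a. a \<in> extensional {lo..hi} \<and>
        (\<Sum>i=lo..hi. Polynomial.smult (a i) (dual_fac x lo hi i)) = 1"
  obtain a where "(\<Sum>i=lo..hi. Polynomial.smult (a i) (dual_fac x lo hi i)) = 1"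
    using dual_span[OF assms, of 1] by auto
  then have a: "?P (restrict a {lo..hi})" by simp
  have "b = c" if "?P b" "?P c" for b c
  proof -
    have "(\<Sum>i=lo..hi. Polynomial.smult (b i - c i) (dual_fac x lo hi i)) = 0"
      using that by (simp add: smult_diff_left sum_subtractf)
    from dual_independent[OF assms this] show ?thesis
      using that by (intro extensionalityI[of _ "{lo..hi}"]) auto
  qed
  then have "?P (dual_coeff x lo hi)"
    unfolding dual_coeff_def by (intro theI[where P = ?P, OF a]) (use a in blast)
  then show ?thesis by blast
qed

section \<open>Solutions of the three-term relations\<close>

text \<open>Induction on \<open>hi\<close>. The new relation determines the new entry unless
  \<open>z\<close> is the new node; in that case the older entries are forced to be zero.\<close>

lemma three_term_kernel:
  assumes "lo \<le> hi" "inj_on x {lo..Suc hi}"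
    and "\<And>j. lo \<le> j \<Longrightarrow> j < hi \<Longrightarrow> (z - x (Suc (Suc j))) * v (Suc j) = (z - x j) * v j"
  shows "\<exists>u. \<forall>j\<in>{lo..hi}. v j = poly (dual_fac x lo hi j) z * u"
  using assms
proof (induction hi rule: dec_induct)
  case base
  then show ?case by (simp add: dual_fac_self)
next
  case (step hi)
  let ?m = "Suc (Suc hi)"
  have "inj_on x {lo..Suc hi}"
    using step.prems(1) by (rule inj_on_subset) auto
  then obtain u where u: "\<forall>j\<in>{lo..hi}. v j = poly (dual_fac x lo hi j) z * u"
    using step by auto
  \<comment> \<open>The last dual factor is the product over \<open>lo..hi-1\<close>, so one more
    factor completes it to \<open>hi\<close>. The case \<open>hi = lo\<close> is separate because
    \<open>dual_fac_last\<close> speaks of a successor index.\<close>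
  have d: "(z - x hi) * poly (dual_fac x lo hi hi) z = poly (gam_prod x lo hi) z"
  proof (cases "hi = lo")
    case True
    then show ?thesis by (simp add: dual_fac_self gam_prod_def)
  next
    case False
    with step.hyps obtain h where "hi = Suc h" "lo \<le> h" by (cases hi) auto
    then show ?thesis by (simp add: dual_fac_last gam_prod_Suc)
  qed
  have "(z - x ?m) * v (Suc hi) = ((z - x hi) * poly (dual_fac x lo hi hi) z) * u"
    using step u by simp
  then have v: "(z - x ?m) * v (Suc hi) = poly (gam_prod x lo hi) z * u"
    by (simp only: d)
  show ?case
  proof (cases "z = x ?m")
    case False
    \<comment> \<open>The old dual factors gain the factor \<open>z - x ?m\<close>, which the new
      multiplier \<open>u / (z - x ?m)\<close> compensates.\<close>
    then have "\<forall>j\<in>{lo..Suc hi}. v j = poly (dual_fac x lo (Suc hi) j) z * (u / (z - x ?m))"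
      using u v step.hyps by (auto simp: le_Suc_eq dual_fac_Suc dual_fac_last field_simps)
    then show ?thesis by blast
  next
    case True
    then have nz: "poly (gam_prod x lo hi) z \<noteq> 0"
      using step by (simp only: True) (intro poly_gam_prod_neq_0, auto)
    \<comment> \<open>At the new node the relation reads 0 = product times \<open>u\<close>. The
      lower entries therefore vanish, the last one is free, and the new multiplier is that entry
      divided by the nonzero last dual factor.\<close>
    with v True have "u = 0" by simp
    with u True nz step.hyps have "\<forall>j\<in>{lo..Suc hi}. v j =
        poly (dual_fac x lo (Suc hi) j) z * (v (Suc hi) / poly (gam_prod x lo hi) z)"
      by (auto simp: le_Suc_eq dual_fac_Suc dual_fac_last)
    then show ?thesis by blast
  qed
qed

text \<open>The first and the last equation contain one unknown each, so elimination can start at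
  either end. Going up divides by \<open>z - x i\<close> with \<open>i \<le> j\<close>, going down
  by \<open>z - x i\<close> with \<open>i \<ge> j + 2\<close>; since \<open>z\<close> equals at most
  one node, one direction reaches \<open>v j\<close>.\<close>

lemma three_term_injective:
  fixes v :: "nat \<Rightarrow> complex"
  assumes inj: "inj_on x {lo..Suc hi}"
    and eq: "\<And>i. lo \<le> i \<Longrightarrow> i \<le> hi \<Longrightarrow>
      (if lo < i then (z - x (Suc i)) * v (i - 1) else 0) = (if i < hi then (z - x i) * v i else 0)"
    and j: "lo \<le> j" "j < hi"
  shows "v j = 0"
proof (cases "\<forall>i\<in>{lo..j}. z \<noteq> x i")
  case True
  with j show ?thesis
  proof (induction j rule: dec_induct)
    case base
    then show ?case using eq[of lo] by auto
  next
    case (step j)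
    then show ?case using eq[of "Suc j"] by auto
  qed
next
  case False
  \<comment> \<open>Now \<open>z\<close> is a node of index at most \<open>j\<close>, so by
    distinctness it is none of the nodes needed for the elimination from above.\<close>
  then have up: "\<forall>i\<in>{Suc (Suc j)..Suc hi}. z \<noteq> x i"
    using inj j by (fastforce dest: inj_onD)
  from j obtain h where h: "hi = Suc h" "j \<le> h" by (cases hi) auto
  from h(2) j(1) up show ?thesis
  proof (induction j rule: inc_induct)
    case base
    then show ?case using eq[of hi] by (auto simp: h)
  next
    case (step i)
    then show ?case using eq[of "Suc i"] by (auto simp: h)
  qed
qed

section \<open>Block matrices\<close>

text \<open>The paper lists blocks by decreasing index: \<open>dmat n a b c d F\<close> has block rows
  \<open>b - 1, \<dots>, a\<close> and block columns \<open>d - 1, \<dots>, c\<close>, from top to bottom and left to right, and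
  \<open>F i j s t\<close> is the \<open>(s, t)\<close> entry of the block with indices \<open>(i, j)\<close>.\<close>

definition dmat :: "nat \<Rightarrow> nat \<Rightarrow> nat \<Rightarrow> nat \<Rightarrow> nat \<Rightarrow> (nat \<Rightarrow> nat \<Rightarrow> nat \<Rightarrow> nat \<Rightarrow> 'a) \<Rightarrow> 'a mat" where
  "dmat n a b c d F = mat ((b - a) * n) ((d - c) * n)
     (\<lambda>(i, j). F (b - 1 - i div n) (d - 1 - j div n) (i mod n) (j mod n))"

definition dvec :: "nat \<Rightarrow> nat \<Rightarrow> nat \<Rightarrow> (nat \<Rightarrow> nat \<Rightarrow> 'a) \<Rightarrow> 'a vec" where
  "dvec n a b w = vec ((b - a) * n) (\<lambda>i. w (b - 1 - i div n) (i mod n))"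

lemma dmat_carrier [simp]: "dmat n a b c d F \<in> carrier_mat ((b - a) * n) ((d - c) * n)"
  by (simp add: dmat_def)

lemma dvec_carrier [simp]: "dvec n a b w \<in> carrier_vec ((b - a) * n)"
  by (simp add: dvec_def)

lemma block_index:
  fixes i n a b :: nat
  assumes "i < (b - a) * n"
  shows "b - Suc (i div n) \<in> {a..<b}" "i mod n < n" "i div n < b - a"
proof -
  show *: "i div n < b - a" using assms by (simp add: less_mult_imp_div_less)
  then show "b - Suc (i div n) \<in> {a..<b}" by auto
  show "i mod n < n" using assms by (cases n) auto
qed

lemma dmat_cong:
  assumes "\<And>i j s t. i \<in> {a..<b} \<Longrightarrow> j \<in> {c..<d} \<Longrightarrow> s < n \<Longrightarrow> t < n \<Longrightarrow> F i j s t = G i j s t"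
  shows "dmat n a b c d F = dmat n a b c d G"
  unfolding dmat_def
  by (intro cong_mat refl) (auto intro!: assms simp del: atLeastLessThan_iff simp: block_index)

lemma dvec_cong:
  assumes "\<And>i s. i \<in> {a..<b} \<Longrightarrow> s < n \<Longrightarrow> v i s = w i s"
  shows "dvec n a b v = dvec n a b w"
  unfolding dvec_def
  by (intro eq_vecI) (auto intro!: assms simp del: atLeastLessThan_iff simp: block_index)

lemma dvec_nth:
  assumes "i \<in> {a..<b}" "s < n"
  shows "(b - 1 - i) * n + s < (b - a) * n" "dvec n a b v $ ((b - 1 - i) * n + s) = v i s"
proof -
  have "(b - 1 - i) * n + s < Suc (b - 1 - i) * n" using assms by simp
  also have "\<dots> \<le> (b - a) * n" using assms by (intro mult_right_mono) auto
  finally show *: "(b - 1 - i) * n + s < (b - a) * n" .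
  show "dvec n a b v $ ((b - 1 - i) * n + s) = v i s"
    unfolding dvec_def using * assms by simp
qed

lemma dvec_eq_iff:
  "dvec n a b v = dvec n a b w \<longleftrightarrow> (\<forall>i\<in>{a..<b}. \<forall>s<n. v i s = w i s)"
proof
  assume "dvec n a b v = dvec n a b w"
  then show "\<forall>i\<in>{a..<b}. \<forall>s<n. v i s = w i s"
    by (metis dvec_nth(2))
qed (auto intro: dvec_cong)

lemma dvec_exhaust:
  assumes "v \<in> carrier_vec ((b - a) * n)"
  obtains w where "v = dvec n a b w"
proof
  show "v = dvec n a b (\<lambda>i s. v $ ((b - 1 - i) * n + s))"
    unfolding dvec_def using assms
    by (intro eq_vecI) (auto dest!: block_index(3))
qed

lemma dvec_0: "0\<^sub>v ((b - a) * n) = dvec n a b (\<lambda>_ _. 0)"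
  by (auto simp: dvec_def)

lemma dvec_add:
  "dvec n a b v + dvec n a b w = dvec n a b (\<lambda>i s. v i s + (w i s :: 'a :: plus))"
  by (auto simp: dvec_def)

text \<open>Turns the flat sums of matrix-vector products into double sums over block index and
  offset; the decreasing enumeration of the blocks does not affect the sum.\<close>

lemma sum_blocks:
  fixes f :: "nat \<Rightarrow> nat \<Rightarrow> 'a :: comm_monoid_add"
  shows "(\<Sum>i=0..<(b - a) * n. f (b - 1 - i div n) (i mod n)) = (\<Sum>j=a..<b. \<Sum>q<n. f j q)"
proof -
  let ?g = "\<lambda>i. f (b - 1 - i div n) (i mod n)"
  have "(\<Sum>i=0..<(b - a) * n. ?g i) = (\<Sum>m<b - a. sum ?g {m * n..<m * n + n})"
    by (simp only: sum.nat_group atLeast0LessThan)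
  also have "\<dots> = (\<Sum>m<b - a. \<Sum>q<n. f (b - 1 - m) q)"
  proof (rule sum.cong[OF refl])
    fix m assume "m \<in> {..<b - a}"
    show "sum ?g {m * n..<m * n + n} = (\<Sum>q<n. f (b - 1 - m) q)"
      using sum.shift_bounds_nat_ivl[of ?g 0 "m * n" n]
      by (simp add: lessThan_atLeast0 add.commute)
  qed
  also have "\<dots> = (\<Sum>j=a..<b. \<Sum>q<n. f j q)"
    by (rule sum.reindex_bij_witness[of _ "\<lambda>j. b - 1 - j" "\<lambda>m. b - 1 - m"]) auto
  finally show ?thesis .
qed

lemma dmat_mult_dvec:
  "dmat n a b c d F *\<^sub>v dvec n c d w = dvec n a b (\<lambda>i s. \<Sum>j=c..<d. \<Sum>q<n. F i j s q * w j q)"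
proof (rule eq_vecI)
  fix i assume "i < dim_vec (dvec n a b (\<lambda>i s. \<Sum>j=c..<d. \<Sum>q<n. F i j s q * w j q))"
  then have i: "i < (b - a) * n" by (simp add: dvec_def)
  have "(dmat n a b c d F *\<^sub>v dvec n c d w) $ i = (\<Sum>l=0..<(d - c) * n.
      F (b - 1 - i div n) (d - 1 - l div n) (i mod n) (l mod n) * w (d - 1 - l div n) (l mod n))"
    using i by (simp add: dmat_def dvec_def scalar_prod_def)
  also have "\<dots> = (\<Sum>j=c..<d. \<Sum>q<n. F (b - 1 - i div n) j (i mod n) q * w j q)"
    by (rule sum_blocks[of "\<lambda>j q. F (b - 1 - i div n) j (i mod n) q * w j q"])
  finally show "(dmat n a b c d F *\<^sub>v dvec n c d w) $ i =
      dvec n a b (\<lambda>i s. \<Sum>j=c..<d. \<Sum>q<n. F i j s q * w j q) $ i"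
    using i by (simp add: dvec_def)
qed (simp add: dmat_def dvec_def)

lemma transpose_dmat:
  "transpose_mat (dmat n a b c d F) = dmat n c d a b (\<lambda>i j s t. F j i t s)"
  by (rule eq_matI) (auto simp: dmat_def)

lemma block_mat_dmat:
  "block_mat n (b - a) (d - c) f = dmat n a b c d (\<lambda>i j s t. f (b - 1 - i) (d - 1 - j) $$ (s, t))"
  unfolding block_mat_def dmat_def
  by (intro cong_mat refl) (auto dest!: block_index(3))

lemma eval_dmat:
  "eval_mat (dmat n a b c d F) z = dmat n a b c d (\<lambda>i j s t. poly (F i j s t) z)"
  by (rule eq_matI) (auto simp: eval_mat_def dmat_def)

section \<open>Kernel vectors of a block matrix with zero lower right block\<close>

lemma add_vec_left_imp_eq:
  fixes u :: "'a :: cancel_semigroup_add vec"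
  assumes "u \<in> carrier_vec n" "v \<in> carrier_vec n" "w \<in> carrier_vec n" "u + v = u + w"
  shows "v = w"
proof (rule eq_vecI)
  fix i assume "i < dim_vec w"
  then show "v $ i = w $ i"
    using arg_cong[OF assms(4), of "\<lambda>y :: 'a vec. y $ i"] assms(1-3) by simp
qed (use assms in auto)

text \<open>\<open>E\<close> annihilates the range of \<open>A\<close> and is a left inverse of
  \<open>Z\<close>. Applying it to the first block row eliminates the lower part of the vector and
  leaves \<open>P\<close> applied to \<open>u\<close>, where \<open>D\<close> maps \<open>u\<close>
  to the upper part. Once this is zero, injectivity of \<open>A\<close> identifies the lower part
  with \<open>H\<close> applied to \<open>u\<close>.\<close>

lemma saddle_kernel:
  fixes M A B D H Z E P :: "'a :: comm_ring_1 mat"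
  assumes [simp]: "M \<in> carrier_mat p q" "A \<in> carrier_mat p r" "B \<in> carrier_mat s q"
    "D \<in> carrier_mat q n" "H \<in> carrier_mat r n" "Z \<in> carrier_mat p n" "E \<in> carrier_mat n p"
    "P \<in> carrier_mat n n"
    and B_ker: "\<And>v. v \<in> carrier_vec q \<Longrightarrow> B *\<^sub>v v = 0\<^sub>v s \<Longrightarrow> \<exists>u\<in>carrier_vec n. v = D *\<^sub>v u"
    and BD: "\<And>u. u \<in> carrier_vec n \<Longrightarrow> B *\<^sub>v (D *\<^sub>v u) = 0\<^sub>v s"
    and D_inj: "\<And>u. u \<in> carrier_vec n \<Longrightarrow> D *\<^sub>v u = 0\<^sub>v q \<Longrightarrow> u = 0\<^sub>v n"
    and A_inj: "\<And>v. v \<in> carrier_vec r \<Longrightarrow> A *\<^sub>v v = 0\<^sub>v p \<Longrightarrow> v = 0\<^sub>v r"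
    and EA: "\<And>v. v \<in> carrier_vec r \<Longrightarrow> E *\<^sub>v (A *\<^sub>v v) = 0\<^sub>v n"
    and EZ: "\<And>u. u \<in> carrier_vec n \<Longrightarrow> E *\<^sub>v (Z *\<^sub>v u) = u"
    and MD: "\<And>u. u \<in> carrier_vec n \<Longrightarrow> M *\<^sub>v (D *\<^sub>v u) + A *\<^sub>v (H *\<^sub>v u) = Z *\<^sub>v (P *\<^sub>v u)"
  shows "z \<in> carrier_vec (q + r) \<and> z \<noteq> 0\<^sub>v (q + r) \<and>
      four_block_mat M A B (0\<^sub>m s r) *\<^sub>v z = 0\<^sub>v (p + s) \<longleftrightarrow>
    (\<exists>u. u \<in> carrier_vec n \<and> u \<noteq> 0\<^sub>v n \<and> P *\<^sub>v u = 0\<^sub>v n \<and> z = (D @\<^sub>r H) *\<^sub>v u)"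
proof -
  have zero: "X *\<^sub>v 0\<^sub>v k = 0\<^sub>v l" if "X \<in> carrier_mat l k" for X :: "'a mat" and l k
    using that by (auto intro!: eq_vecI)
  note [simp] = assms(1-8)[THEN zero]
  have split_zero: "0\<^sub>v (l + k) = 0\<^sub>v l @\<^sub>v (0\<^sub>v k :: 'a vec)" for l k
    by (auto intro!: eq_vecI)
  note [simp] = assms(1-8)[THEN mult_mat_vec_carrier]
  have L: "four_block_mat M A B (0\<^sub>m s r) *\<^sub>v (v1 @\<^sub>v v2) = 0\<^sub>v (p + s) \<longleftrightarrow>
      M *\<^sub>v v1 + A *\<^sub>v v2 = 0\<^sub>v p \<and> B *\<^sub>v v1 = 0\<^sub>v s"
    if [simp]: "v1 \<in> carrier_vec q" "v2 \<in> carrier_vec r" for v1 v2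
  proof -
    have "four_block_mat M A B (0\<^sub>m s r) *\<^sub>v (v1 @\<^sub>v v2) =
        (M *\<^sub>v v1 + A *\<^sub>v v2) @\<^sub>v (B *\<^sub>v v1 + 0\<^sub>m s r *\<^sub>v v2)"
      by (rule four_block_mat_mult_vec[OF assms(1-3) zero_carrier_mat that])
    also have "0\<^sub>m s r *\<^sub>v v2 = 0\<^sub>v s"
      using that by (auto intro!: eq_vecI)
    also have "B *\<^sub>v v1 + 0\<^sub>v s = B *\<^sub>v v1"
      by (rule right_zero_vec[of _ s]) simp
    finally show ?thesis
      unfolding split_zero by (simp add: append_vec_eq[of _ p])
  qed
  show ?thesis
  proof
    assume z: "z \<in> carrier_vec (q + r) \<and> z \<noteq> 0\<^sub>v (q + r) \<and>
      four_block_mat M A B (0\<^sub>m s r) *\<^sub>v z = 0\<^sub>v (p + s)"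
    define z1 z2 where "z1 = vec_first z q" and "z2 = vec_last z r"
    have z1 [simp]: "z1 \<in> carrier_vec q" and z2 [simp]: "z2 \<in> carrier_vec r"
      by (simp_all add: z1_def z2_def)
    have zz: "z = z1 @\<^sub>v z2" using z by (simp add: z1_def z2_def)
    from z have eq: "M *\<^sub>v z1 + A *\<^sub>v z2 = 0\<^sub>v p" "B *\<^sub>v z1 = 0\<^sub>v s"
      using L[OF z1 z2] zz by auto
    from B_ker[OF z1 eq(2)] obtain u where u [simp]: "u \<in> carrier_vec n" and z1u: "z1 = D *\<^sub>v u"
      by blast
    let ?m = "M *\<^sub>v (D *\<^sub>v u)"
    have m [simp]: "?m \<in> carrier_vec p" by simp
    \<comment> \<open>The value does not depend on \<open>v\<close>. It is used twice: with the
      actual lower part \<open>z2\<close>, giving 0, and with the candidate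
      \<open>H *\<^sub>v u\<close>, giving \<open>P *\<^sub>v u\<close>.\<close>
    have Em: "E *\<^sub>v (?m + A *\<^sub>v v) = E *\<^sub>v ?m" if "v \<in> carrier_vec r" for v
    proof -
      have "E *\<^sub>v (?m + A *\<^sub>v v) = E *\<^sub>v ?m + E *\<^sub>v (A *\<^sub>v v)"
        using that by (intro mult_add_distrib_mat_vec[OF assms(7)]) auto
      then show ?thesis using that by (simp add: EA)
    qed
    have "E *\<^sub>v ?m = 0\<^sub>v n"
      using Em[OF z2] eq(1) z1u by simp
    moreover have "E *\<^sub>v ?m = P *\<^sub>v u"
      using Em[of "H *\<^sub>v u"] MD[OF u] EZ[of "P *\<^sub>v u"] by simp
    ultimately have Pu: "P *\<^sub>v u = 0\<^sub>v n" by simp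
    have "?m + A *\<^sub>v (H *\<^sub>v u) = 0\<^sub>v p"
      using MD[OF u] Pu by simp
    then have "?m + A *\<^sub>v z2 = ?m + A *\<^sub>v (H *\<^sub>v u)"
      using eq(1) z1u by simp
    then have "A *\<^sub>v z2 = A *\<^sub>v (H *\<^sub>v u)"
      by (rule add_vec_left_imp_eq[of _ p, rotated 3]) simp_all
    then have "A *\<^sub>v (z2 - H *\<^sub>v u) = 0\<^sub>v p"
      by (simp add: mult_minus_distrib_mat_vec[of _ p r])
    then have "z2 - H *\<^sub>v u = 0\<^sub>v r"
      by (intro A_inj) auto
    then have z2u: "z2 = H *\<^sub>v u"
      by (intro eq_vecI) (auto simp: vec_eq_iff)
    have zu: "z = (D @\<^sub>r H) *\<^sub>v u"
      using zz z1u z2u by (simp add: mat_mult_append[of _ q n _ r])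
    moreover have "u \<noteq> 0\<^sub>v n"
      using z zz z1u z2u by (auto simp: split_zero)
    ultimately show "\<exists>u. u \<in> carrier_vec n \<and> u \<noteq> 0\<^sub>v n \<and> P *\<^sub>v u = 0\<^sub>v n \<and> z = (D @\<^sub>r H) *\<^sub>v u"
      using Pu by (intro exI[of _ u]) simp
  next
    assume "\<exists>u. u \<in> carrier_vec n \<and> u \<noteq> 0\<^sub>v n \<and> P *\<^sub>v u = 0\<^sub>v n \<and> z = (D @\<^sub>r H) *\<^sub>v u"
    then obtain u where u [simp]: "u \<in> carrier_vec n" and nz: "u \<noteq> 0\<^sub>v n"
      and Pu: "P *\<^sub>v u = 0\<^sub>v n" and z: "z = (D @\<^sub>r H) *\<^sub>v u" by blast
    have z': "z = D *\<^sub>v u @\<^sub>v H *\<^sub>v u"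
      unfolding z by (simp add: mat_mult_append[of _ q n _ r])
    have "z \<noteq> 0\<^sub>v (q + r)"
      using D_inj[OF u] nz unfolding z' split_zero by (auto simp: append_vec_eq[of _ q])
    moreover have "four_block_mat M A B (0\<^sub>m s r) *\<^sub>v z = 0\<^sub>v (p + s)"
      unfolding z' by (subst L) (simp_all add: MD BD Pu)
    ultimately show "z \<in> carrier_vec (q + r) \<and> z \<noteq> 0\<^sub>v (q + r) \<and>
      four_block_mat M A B (0\<^sub>m s r) *\<^sub>v z = 0\<^sub>v (p + s)"
      by (simp add: z')
  qed
qed

section \<open>The bidiagonal pencils\<close>

text \<open>Both sides are the product over \<open>lo..hi+1\<close> with the single factor
  \<open>gam x (Suc j)\<close> left out.\<close>

lemma dual_fac_three_term:
  assumes "lo \<le> j" "j < hi"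
  shows "dual_fac x lo hi (Suc j) * gam x (Suc (Suc j)) = dual_fac x lo hi j * gam x j"
proof -
  have "dual_fac x lo hi (Suc j) * gam x (Suc (Suc j)) * gam x (Suc j) = gam_prod x lo (Suc hi)"
    using dual_fac_mult[of lo "Suc j" hi x] assms by (simp add: mult_ac)
  also have "\<dots> = dual_fac x lo hi j * gam x j * gam x (Suc j)"
    using dual_fac_mult[of lo j hi x] assms by (simp add: mult_ac)
  finally show ?thesis by (simp only: mult_cancel_right) simp
qed

lemma poly_dual_fac_three_term:
  assumes "lo \<le> j" "j < hi"
  shows "(z - x (Suc (Suc j))) * poly (dual_fac x lo hi (Suc j)) z =
    (z - x j) * poly (dual_fac x lo hi j) z"
  using arg_cong[OF dual_fac_three_term[OF assms], of "\<lambda>p. poly p z"] by (simp add: mult.commute)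

lemma poly_dual_coeff_sum:
  assumes "lo \<le> hi" "inj_on x {lo..Suc hi}"
  shows "(\<Sum>i=lo..hi. dual_coeff x lo hi i * poly (dual_fac x lo hi i) z) = 1"
  using arg_cong[OF dual_coeff_sum[OF assms], of "\<lambda>p. poly p z"] by (simp add: poly_sum)

text \<open>Common form of the two pencils K evaluated at \<open>z\<close>: the range
  \<open>\<mu>+1..k\<close> gives \<open>K1\<close>, the range \<open>1..\<mu>+1\<close> gives
  \<open>K2\<close>.\<close>

definition bidiag_mat :: "nat \<Rightarrow> nat \<Rightarrow> nat \<Rightarrow> (nat \<Rightarrow> complex) \<Rightarrow> complex \<Rightarrow> complex mat" where
  "bidiag_mat n lo hi x z = dmat n lo hi lo (Suc hi) (\<lambda>i j s t. if s = t then
     (if j = Suc i then z - x (Suc (Suc i)) else if j = i then x i - z else 0) else 0)"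

text \<open>The transposed block rows \<open>D1\<close> and \<open>D2\<close> evaluated at
  \<open>z\<close>, for the same two ranges.\<close>

definition dual_mat :: "nat \<Rightarrow> nat \<Rightarrow> nat \<Rightarrow> (nat \<Rightarrow> complex) \<Rightarrow> complex \<Rightarrow> complex mat" where
  "dual_mat n lo hi x z = dmat n lo (Suc hi) 0 1 (\<lambda>j _ s t. if s = t then
     poly (dual_fac x lo hi j) z else 0)"

lemma bidiag_carrier: "bidiag_mat n lo hi x z \<in> carrier_mat ((hi - lo) * n) ((Suc hi - lo) * n)"
  by (simp add: bidiag_mat_def)

lemma sum_diag:
  fixes w :: "nat \<Rightarrow> 'a :: semiring_0"
  shows "s < n \<Longrightarrow> (\<Sum>q<n. (if s = q then c else 0) * w q) = c * w s"
    "s < n \<Longrightarrow> (\<Sum>q<n. (if q = s then c else 0) * w q) = c * w s"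
  by (simp_all add: if_distrib[of "\<lambda>y. y * _"] cong: if_cong)

lemma bidiag_mult:
  "bidiag_mat n lo hi x z *\<^sub>v dvec n lo (Suc hi) w =
    dvec n lo hi (\<lambda>i s. (z - x (Suc (Suc i))) * w (Suc i) s - (z - x i) * w i s)"
  unfolding bidiag_mat_def dmat_mult_dvec
proof (rule dvec_cong)
  fix i s assume i: "i \<in> {lo..<hi}" and s: "s < n"
  let ?k = "\<lambda>j. if j = Suc i then z - x (Suc (Suc i)) else if j = i then x i - z else 0"
  have "(\<Sum>j=lo..<Suc hi. \<Sum>q<n. (if s = q then ?k j else 0) * w j q) =
      (\<Sum>j=lo..<Suc hi. (if j = Suc i then (z - x (Suc (Suc i))) * w j s else 0) +
         (if j = i then (x i - z) * w j s else 0))"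
    using s by (intro sum.cong refl) (simp add: sum_diag)
  also have "\<dots> = (z - x (Suc (Suc i))) * w (Suc i) s - (z - x i) * w i s"
    using i by (simp add: sum.distrib algebra_simps del: sum.op_ivl_Suc)
  finally show "(\<Sum>j=lo..<Suc hi. \<Sum>q<n. (if s = q then ?k j else 0) * w j q) =
      (z - x (Suc (Suc i))) * w (Suc i) s - (z - x i) * w i s" .
qed

lemma bidiag_transpose_mult:
  "transpose_mat (bidiag_mat n lo hi x z) *\<^sub>v dvec n lo hi w =
    dvec n lo (Suc hi) (\<lambda>i s. (if lo < i then (z - x (Suc i)) * w (i - 1) s else 0) -
      (if i < hi then (z - x i) * w i s else 0))"
  unfolding bidiag_mat_def transpose_dmat dmat_mult_dvec
proof (rule dvec_cong)
  fix i s assume i: "i \<in> {lo..<Suc hi}" and s: "s < n"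
  let ?k = "\<lambda>j. if i = Suc j then z - x (Suc (Suc j)) else if i = j then x j - z else 0"
  \<comment> \<open>Only \<open>j = i - 1\<close> and \<open>j = i\<close> contribute. The guard
    \<open>lo < i\<close> is needed for \<open>i = lo = 0\<close>, where the truncated
    \<open>i - 1\<close> would still lie in the range.\<close>
  have "(\<Sum>j=lo..<hi. \<Sum>q<n. (if q = s then ?k j else 0) * w j q) =
      (\<Sum>j=lo..<hi. (if j = i - 1 then (if lo < i then (z - x (Suc i)) * w (i - 1) s else 0) else 0) +
         (if j = i then (x i - z) * w i s else 0))"
    using s i by (intro sum.cong refl) (auto simp: sum_diag)
  also have "\<dots> = (if lo < i then (z - x (Suc i)) * w (i - 1) s else 0) -
      (if i < hi then (z - x i) * w i s else 0)"
    using i by (auto simp add: sum.distrib algebra_simps)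
  finally show "(\<Sum>j=lo..<hi. \<Sum>q<n. (if q = s then ?k j else 0) * w j q) =
      (if lo < i then (z - x (Suc i)) * w (i - 1) s else 0) -
      (if i < hi then (z - x i) * w i s else 0)" .
qed

lemma dual_mat_mult:
  "dual_mat n lo hi x z *\<^sub>v dvec n 0 1 u =
    dvec n lo (Suc hi) (\<lambda>j s. poly (dual_fac x lo hi j) z * u 0 s)"
  unfolding dual_mat_def dmat_mult_dvec by (rule dvec_cong) (simp add: sum_diag)

lemma dual_mat_transpose_mult:
  "transpose_mat (dual_mat n lo hi x z) *\<^sub>v dvec n lo (Suc hi) w =
    dvec n 0 1 (\<lambda>_ s. \<Sum>j=lo..hi. poly (dual_fac x lo hi j) z * w j s)"
  unfolding dual_mat_def transpose_dmat dmat_mult_dvec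
  by (rule dvec_cong) (simp add: sum_diag atLeastLessThanSuc_atLeastAtMost del: sum.op_ivl_Suc)

text \<open>Summation by parts: after a shift of index, the three-term relation of the dual factors
  makes the first sum equal to the second. This says that the dual block row annihilates the
  transposed bidiagonal pencil.\<close>

lemma dual_bidiag_orthogonal:
  "(\<Sum>i=lo..hi. poly (dual_fac x lo hi i) z *
     ((if lo < i then (z - x (Suc i)) * w (i - 1) else 0) - (if i < hi then (z - x i) * w i else 0))) = 0"
  (is "(\<Sum>i=lo..hi. ?d i * _) = 0")
proof -
  have "(\<Sum>i=lo..hi. ?d i * (if lo < i then (z - x (Suc i)) * w (i - 1) else 0)) =
      (\<Sum>i\<in>{i\<in>{lo..hi}. lo < i}. ?d i * ((z - x (Suc i)) * w (i - 1)))"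
    by (rule sum.mono_neutral_cong_right) auto
  also have "\<dots> = (\<Sum>j=lo..<hi. ?d (Suc j) * ((z - x (Suc (Suc j))) * w j))"
    by (rule sum.reindex_bij_witness[of _ Suc "\<lambda>i. i - 1"]) auto
  also have "\<dots> = (\<Sum>j=lo..<hi. ?d j * ((z - x j) * w j))"
  proof (intro sum.cong refl)
    fix j assume "j \<in> {lo..<hi}"
    then show "?d (Suc j) * ((z - x (Suc (Suc j))) * w j) = ?d j * ((z - x j) * w j)"
      using poly_dual_fac_three_term[of lo j hi z x]
      by (metis atLeastLessThan_iff mult.assoc mult.commute)
  qed
  also have "\<dots> = (\<Sum>i=lo..hi. ?d i * (if i < hi then (z - x i) * w i else 0))"
    by (rule sum.mono_neutral_cong_left) auto
  finally show ?thesis by (simp add: right_diff_distrib sum_subtractf)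
qed

text \<open>Instance of \<open>saddle_kernel\<close> for arbitrary index ranges, so that it serves
  both the pencil and its transpose. \<open>F\<close> holds the entries of M, \<open>h\<close> those
  of the lower recovery blocks and \<open>p\<close> those of the matrix polynomial, all evaluated at
  \<open>z\<close>; \<open>rows\<close> is the entrywise form of the central identity.\<close>

lemma pencil_kernel:
  fixes F :: "nat \<Rightarrow> nat \<Rightarrow> nat \<Rightarrow> nat \<Rightarrow> complex"
  assumes le: "lo1 \<le> hi1" "lo2 \<le> hi2"
    and inj1: "inj_on x {lo1..Suc hi1}" and inj2: "inj_on x {lo2..Suc hi2}"
    and rows: "\<And>i s t. lo2 \<le> i \<Longrightarrow> i \<le> hi2 \<Longrightarrow> s < n \<Longrightarrow> t < n \<Longrightarrow>
      (\<Sum>j=lo1..hi1. F i j s t * poly (dual_fac x lo1 hi1 j) z) +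
      ((if lo2 < i then (z - x (Suc i)) * h (i - 1) s t else 0) -
       (if i < hi2 then (z - x i) * h i s t else 0)) = dual_coeff x lo2 hi2 i * p s t"
  shows "v \<in> carrier_vec ((Suc hi1 - lo1) * n + (hi2 - lo2) * n) \<and>
      v \<noteq> 0\<^sub>v ((Suc hi1 - lo1) * n + (hi2 - lo2) * n) \<and>
      four_block_mat (dmat n lo2 (Suc hi2) lo1 (Suc hi1) F) (transpose_mat (bidiag_mat n lo2 hi2 x z))
        (bidiag_mat n lo1 hi1 x z) (0\<^sub>m ((hi1 - lo1) * n) ((hi2 - lo2) * n)) *\<^sub>v v =
      0\<^sub>v ((Suc hi2 - lo2) * n + (hi1 - lo1) * n) \<longleftrightarrow>
    (\<exists>u. u \<in> carrier_vec n \<and> u \<noteq> 0\<^sub>v n \<and> dmat n 0 1 0 1 (\<lambda>_ _. p) *\<^sub>v u = 0\<^sub>v n \<and>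
       v = (dual_mat n lo1 hi1 x z @\<^sub>r dmat n lo2 hi2 0 1 (\<lambda>i _. h i)) *\<^sub>v u)"
proof -
  let ?d = "\<lambda>j. poly (dual_fac x lo1 hi1 j) z" and ?b = "dual_coeff x lo1 hi1"
  let ?e = "\<lambda>i. poly (dual_fac x lo2 hi2 i) z" and ?a = "dual_coeff x lo2 hi2"
  let ?Z = "dmat n lo2 (Suc hi2) 0 1 (\<lambda>i _ s t. if s = t then ?a i else 0)"
  have vec_n: "(\<And>u. v = dvec n 0 1 u \<Longrightarrow> thesis) \<Longrightarrow> thesis"
    if "v \<in> carrier_vec n" for v :: "complex vec" and thesis
    by (rule dvec_exhaust[of v 1 0 n]) (use that in auto)
  have zero_n: "0\<^sub>v n = dvec n 0 1 (\<lambda>_ _. 0 :: complex)"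
    using dvec_0[of 1 0 n] by simp
  have Z: "?Z *\<^sub>v dvec n 0 1 u = dvec n lo2 (Suc hi2) (\<lambda>i s. ?a i * u 0 s)" for u
    unfolding dmat_mult_dvec by (rule dvec_cong) (simp add: sum_diag)
  show ?thesis
  \<comment> \<open>\<open>?Z\<close> stacks the dual coefficients of the second range and
    \<open>E\<close> is the row of its dual factors: the normalisation of the coefficients makes
    \<open>E\<close> a left inverse of \<open>?Z\<close>, and orthogonality makes it kill the
    transposed bidiagonal block.\<close>
  proof (rule saddle_kernel[where Z = ?Z and E = "transpose_mat (dual_mat n lo2 hi2 x z)"])
    show "dmat n lo2 (Suc hi2) lo1 (Suc hi1) F \<in> carrier_mat ((Suc hi2 - lo2) * n) ((Suc hi1 - lo1) * n)"
      "transpose_mat (bidiag_mat n lo2 hi2 x z) \<in> carrier_mat ((Suc hi2 - lo2) * n) ((hi2 - lo2) * n)"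
      "bidiag_mat n lo1 hi1 x z \<in> carrier_mat ((hi1 - lo1) * n) ((Suc hi1 - lo1) * n)"
      "dual_mat n lo1 hi1 x z \<in> carrier_mat ((Suc hi1 - lo1) * n) n"
      "dmat n lo2 hi2 0 1 (\<lambda>i _. h i) \<in> carrier_mat ((hi2 - lo2) * n) n"
      "?Z \<in> carrier_mat ((Suc hi2 - lo2) * n) n"
      "transpose_mat (dual_mat n lo2 hi2 x z) \<in> carrier_mat n ((Suc hi2 - lo2) * n)"
      "dmat n 0 1 0 1 (\<lambda>_ _. p) \<in> carrier_mat n n"
      by (simp_all add: dmat_def dual_mat_def bidiag_mat_def)
  next
    fix v :: "complex vec"
    assume "v \<in> carrier_vec ((Suc hi1 - lo1) * n)"
      and ker: "bidiag_mat n lo1 hi1 x z *\<^sub>v v = 0\<^sub>v ((hi1 - lo1) * n)"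
    then obtain w where v: "v = dvec n lo1 (Suc hi1) w" by (rule_tac dvec_exhaust)
    have eq: "(z - x (Suc (Suc j))) * w (Suc j) s = (z - x j) * w j s"
      if "lo1 \<le> j" "j < hi1" "s < n" for j s
      using ker that unfolding v bidiag_mult dvec_0 dvec_eq_iff by auto
    \<comment> \<open>The blocks of the bidiagonal pencil are scalar multiples of the identity, so
      the relation decouples into one scalar recurrence for each position \<open>s\<close> inside a
      block.\<close>
    have "\<forall>s\<in>{..<n}. \<exists>u. \<forall>j\<in>{lo1..hi1}. w j s = ?d j * u"
      by (intro ballI three_term_kernel[OF le(1) inj1] eq) auto
    from bchoice[OF this] obtain u where u: "\<forall>s\<in>{..<n}. \<forall>j\<in>{lo1..hi1}. w j s = ?d j * u s"
      by blast
    have "v = dual_mat n lo1 hi1 x z *\<^sub>v dvec n 0 1 (\<lambda>_. u)"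
      unfolding v dual_mat_mult by (rule dvec_cong) (use u in auto)
    moreover have "dvec n 0 1 (\<lambda>_. u) \<in> carrier_vec n" by (simp add: dvec_def)
    ultimately show "\<exists>u\<in>carrier_vec n. v = dual_mat n lo1 hi1 x z *\<^sub>v u" by blast
  next
    fix u :: "complex vec" assume "u \<in> carrier_vec n"
    then obtain u' where u: "u = dvec n 0 1 u'" by (rule vec_n)
    show "bidiag_mat n lo1 hi1 x z *\<^sub>v (dual_mat n lo1 hi1 x z *\<^sub>v u) = 0\<^sub>v ((hi1 - lo1) * n)"
      unfolding u dual_mat_mult bidiag_mult dvec_0
      by (rule dvec_cong) (simp add: poly_dual_fac_three_term flip: mult.assoc)
    show "transpose_mat (dual_mat n lo2 hi2 x z) *\<^sub>v (?Z *\<^sub>v u) = u"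
      unfolding u Z dual_mat_transpose_mult
    proof (rule dvec_cong)
      fix i s :: nat assume "i \<in> {0..<1}"
      then show "(\<Sum>j=lo2..hi2. ?e j * (?a j * u' 0 s)) = u' i s"
        using poly_dual_coeff_sum[OF le(2) inj2, of z]
        by (simp add: mult_ac flip: sum_distrib_left)
    qed
    show "dmat n lo2 (Suc hi2) lo1 (Suc hi1) F *\<^sub>v (dual_mat n lo1 hi1 x z *\<^sub>v u) +
        transpose_mat (bidiag_mat n lo2 hi2 x z) *\<^sub>v (dmat n lo2 hi2 0 1 (\<lambda>i _. h i) *\<^sub>v u) =
        ?Z *\<^sub>v (dmat n 0 1 0 1 (\<lambda>_ _. p) *\<^sub>v u)"
      unfolding u dual_mat_mult dmat_mult_dvec[of n lo2 hi2 0 1 "\<lambda>i _. h i"]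
        dmat_mult_dvec[of n 0 1 0 1 "\<lambda>_ _. p"] bidiag_transpose_mult Z
      unfolding dmat_mult_dvec dvec_add
    proof (rule dvec_cong)
      fix i s assume i: "i \<in> {lo2..<Suc hi2}" and s: "s < n"
      have one: "(\<Sum>j=0..<1. f j) = f 0" for f :: "nat \<Rightarrow> complex" by simp
      let ?h = "\<lambda>i. \<Sum>q<n. h i s q * u' 0 q"
      have h1: "(if lo2 < i then c * ?h (i - 1) else 0) =
          (\<Sum>q<n. (if lo2 < i then c * h (i - 1) s q else 0) * u' 0 q)" for c
        by (simp add: sum_distrib_left mult_ac)
      have h2: "(if i < hi2 then c * ?h i else 0) =
          (\<Sum>q<n. (if i < hi2 then c * h i s q else 0) * u' 0 q)" for c
        by (simp add: sum_distrib_left mult_ac)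
      have f: "(\<Sum>j=lo1..<Suc hi1. \<Sum>q<n. F i j s q * (?d j * u' 0 q)) =
          (\<Sum>q<n. (\<Sum>j=lo1..hi1. F i j s q * ?d j) * u' 0 q)"
        unfolding atLeastLessThanSuc_atLeastAtMost
        by (subst sum.swap) (simp add: sum_distrib_left mult_ac)
      \<comment> \<open>Collecting the coefficient of \<open>u' 0 q\<close> produces exactly the
        left side of \<open>rows\<close> for the entry \<open>(s, q)\<close>.\<close>
      have "(\<Sum>j=lo1..<Suc hi1. \<Sum>q<n. F i j s q * (?d j * u' 0 q)) +
          ((if lo2 < i then (z - x (Suc i)) * ?h (i - 1) else 0) -
           (if i < hi2 then (z - x i) * ?h i else 0)) =
        (\<Sum>q<n. ((\<Sum>j=lo1..hi1. F i j s q * ?d j) +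
          ((if lo2 < i then (z - x (Suc i)) * h (i - 1) s q else 0) -
           (if i < hi2 then (z - x i) * h i s q else 0))) * u' 0 q)"
        unfolding h1 h2 f by (simp only: distrib_right left_diff_distrib sum.distrib sum_subtractf)
      also have "\<dots> = (\<Sum>q<n. ?a i * p s q * u' 0 q)"
        using i s by (intro sum.cong refl) (simp add: rows)
      also have "\<dots> = ?a i * (\<Sum>q<n. p s q * u' 0 q)"
        by (simp add: sum_distrib_left mult_ac)
      finally show "(\<Sum>j=lo1..<Suc hi1. \<Sum>q<n. F i j s q * (?d j * u' 0 q)) +
          ((if lo2 < i then (z - x (Suc i)) * (\<Sum>j=0..<1. \<Sum>q<n. h (i - 1) s q * u' j q) else 0) -
           (if i < hi2 then (z - x i) * (\<Sum>j=0..<1. \<Sum>q<n. h i s q * u' j q) else 0)) =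
          ?a i * (\<Sum>j=0..<1. \<Sum>q<n. p s q * u' j q)"
        unfolding one .
    qed
    assume "dual_mat n lo1 hi1 x z *\<^sub>v u = 0\<^sub>v ((Suc hi1 - lo1) * n)"
    then have 0: "?d j * u' 0 s = 0" if "j \<in> {lo1..hi1}" "s < n" for j s
      using that unfolding u dual_mat_mult dvec_0 dvec_eq_iff by auto
    show "u = 0\<^sub>v n"
      unfolding u zero_n
    proof (rule dvec_cong)
      fix i s :: nat assume "i \<in> {0..<1}" and s: "s < n"
      \<comment> \<open>A combination of the dual factors equals 1, so they have no common zero;
        hence \<open>dual_mat\<close> is injective.\<close>
      then have "u' i s = (\<Sum>j=lo1..hi1. ?b j * ?d j) * u' 0 s"
        using poly_dual_coeff_sum[OF le(1) inj1] by simp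
      also have "\<dots> = (\<Sum>j=lo1..hi1. ?b j * (?d j * u' 0 s))"
        by (simp add: sum_distrib_right mult.assoc)
      also have "\<dots> = 0"
        by (rule sum.neutral) (metis 0 s mult_zero_right)
      finally show "u' i s = 0" .
    qed
  next
    fix v :: "complex vec" assume "v \<in> carrier_vec ((hi2 - lo2) * n)"
    then obtain w where v: "v = dvec n lo2 hi2 w" by (rule dvec_exhaust)
    show "transpose_mat (dual_mat n lo2 hi2 x z) *\<^sub>v
        (transpose_mat (bidiag_mat n lo2 hi2 x z) *\<^sub>v v) = 0\<^sub>v n"
      unfolding v bidiag_transpose_mult dual_mat_transpose_mult zero_n
      by (rule dvec_cong) (rule dual_bidiag_orthogonal)
    assume ker: "transpose_mat (bidiag_mat n lo2 hi2 x z) *\<^sub>v v = 0\<^sub>v ((Suc hi2 - lo2) * n)"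
    show "v = 0\<^sub>v ((hi2 - lo2) * n)"
      unfolding v dvec_0
    proof (rule dvec_cong)
      fix j s assume j: "j \<in> {lo2..<hi2}" and s: "s < n"
      have ker': "\<forall>i\<in>{lo2..<Suc hi2}. \<forall>s<n. (if lo2 < i then (z - x (Suc i)) * w (i - 1) s else 0) -
          (if i < hi2 then (z - x i) * w i s else 0) = 0"
        using ker unfolding v bidiag_transpose_mult dvec_0 dvec_eq_iff .
      have eq: "(if lo2 < i then (z - x (Suc i)) * w (i - 1) s else 0) =
          (if i < hi2 then (z - x i) * w i s else 0)" if "lo2 \<le> i" "i \<le> hi2" for i
        by (rule iffD2[OF eq_iff_diff_eq_0], rule ker'[rule_format]) (use that s in auto)
      show "w j s = 0"
        using j by (intro three_term_injective[OF inj2 eq]) auto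
    qed
  qed
qed

section \<open>The recovery polynomials\<close>

text \<open>One entry of \<open>lagrange_sum\<close>, with \<open>p i\<close> the corresponding
  entry of the i-th coefficient matrix. Working entrywise replaces matrix polynomials by scalar
  ones.\<close>

definition lag_sum :: "nat \<Rightarrow> (nat \<Rightarrow> complex) \<Rightarrow> (nat \<Rightarrow> complex) \<Rightarrow> nat set \<Rightarrow> complex poly" where
  "lag_sum k x p I = (\<Sum>i\<in>I. Polynomial.smult (p i * wt k x i) (ell k x div gam x i))"

text \<open>One entry of \<open>aux_poly\<close> with the dual coefficients inserted; it covers both
  families of auxiliary polynomials.\<close>

definition aux_entry ::
  "nat \<Rightarrow> (nat \<Rightarrow> complex) \<Rightarrow> (nat \<Rightarrow> complex) \<Rightarrow> nat \<Rightarrow> nat \<Rightarrow> nat \<Rightarrow> complex poly" where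
  "aux_entry k x p lo hi j =
     - (\<Sum>i=lo..j. Polynomial.smult (dual_coeff x lo hi i)
          ((gam x (j + 1) * lag_sum k x p {j+1..k+1}) div (gam x i * gam x (i + 1))))
     + (\<Sum>i=j+1..hi. Polynomial.smult (dual_coeff x lo hi i)
          ((gam x (j + 1) * lag_sum k x p {1..j}) div (gam x i * gam x (i + 1))))"

lemma ell_div_gam:
  assumes "i \<in> {1..k+1}"
  shows "ell k x div gam x i = (\<Prod>t\<in>{1..k+1} - {i}. gam x t)"
  unfolding ell_def using assms by (subst prod.remove[of _ i]) (simp_all del: prod.cl_ivl_Suc)

lemma ell_div_gam_mult:
  assumes "i \<in> {1..k+1}"
  shows "ell k x div gam x i * gam x i = ell k x"
  unfolding ell_div_gam[OF assms] unfolding ell_def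
  using assms by (simp only: prod.remove[of _ i] finite_atLeastAtMost mult.commute)

lemma gam_mult_ell_div:
  assumes "i \<in> {1..k+1}"
  shows "gam x i * (g * (ell k x div gam x i)) = g * ell k x"
proof -
  have "gam x i * (g * (ell k x div gam x i)) = g * (ell k x div gam x i * gam x i)"
    by (simp only: mult_ac)
  then show ?thesis by (simp only: ell_div_gam_mult[OF assms])
qed

lemma eq_ell_divI:
  assumes "c * gam x t = g * ell k x" "t \<in> {1..k+1}"
  shows "c = g * (ell k x div gam x t)"
proof -
  have "c * gam x t = g * (ell k x div gam x t) * gam x t"
    using assms by (simp add: ell_div_gam_mult mult.assoc)
  then show ?thesis by (simp only: mult_cancel_right) simp
qed

lemma lag_sum_split:
  assumes "a \<le> b" "b \<le> c"
  shows "lag_sum k x p {Suc a..c} = lag_sum k x p {Suc a..b} + lag_sum k x p {Suc b..c}"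
  unfolding lag_sum_def using assms
  by (subst sum.union_disjoint[symmetric]) (auto intro!: sum.cong)

text \<open>Exactness of the divisions in \<open>aux_entry\<close>. The summand for node
  \<open>t\<close> lacks only \<open>gam x t\<close>. As \<open>i\<close> is not in
  \<open>I\<close>, the factor \<open>gam x i\<close> is always present;
  \<open>gam x (Suc i)\<close> is missing only for \<open>t = Suc i\<close>, where
  \<open>j = i\<close> and the prefactor supplies it.\<close>

lemma gam_mult_dvd_lag_sum:
  assumes "1 \<le> i" "i \<le> k" "I \<subseteq> {1..k+1} - {i}" "Suc i \<in> I \<Longrightarrow> j = i"
  shows "gam x i * gam x (Suc i) dvd gam x (Suc j) * lag_sum k x p I"
proof -
  have "gam x i * gam x (Suc i) dvd gam x (Suc j) * (ell k x div gam x t)" if t: "t \<in> I" for t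
  proof (cases "t = Suc i")
    case True
    have "gam x i dvd ell k x div gam x t"
      using assms t by (subst ell_div_gam) (auto intro: dvd_prodI)
    with True t assms(4) show ?thesis
      by (simp add: mult.commute[of "gam x (Suc i)"])
  next
    case False
    with t assms have "gam x i * gam x (Suc i) dvd ell k x div gam x t"
      by (subst ell_div_gam) (auto intro!: gam_mult_dvd_prod)
    then show ?thesis by (rule dvd_mult)
  qed
  then show ?thesis
    unfolding lag_sum_def by (auto simp: sum_distrib_left intro!: dvd_sum dvd_smult)
qed

text \<open>Since the divisions are exact, multiplication by the full product turns each quotient
  into a dual factor times a Lagrange part; the dual factors then collect into partial sums.\<close>

lemma aux_entry_mult:
  assumes "1 \<le> lo" "lo \<le> j" "j < hi" "hi \<le> k" "inj_on x {lo..Suc hi}"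
  shows "aux_entry k x p lo hi j * gam_prod x lo (Suc hi) = gam x (Suc j) *
    (lag_sum k x p {1..j} - (\<Sum>i=lo..<Suc j. Polynomial.smult (dual_coeff x lo hi i) (dual_fac x lo hi i)) *
       lag_sum k x p {1..k+1})"
proof -
  let ?N = "gam_prod x lo (Suc hi)" and ?a = "dual_coeff x lo hi" and ?e = "dual_fac x lo hi"
  let ?S = "lag_sum k x p {j+1..k+1}" and ?T = "lag_sum k x p {1..j}"
  \<comment> \<open>Used for \<open>I = {j+1..k+1}\<close> with \<open>i \<le> j\<close>, where
    \<open>Suc i\<close> lies in \<open>I\<close> only if \<open>i = j\<close>, and for
    \<open>I = {1..j}\<close> with \<open>i > j\<close>, where it never does.\<close>
  have quot: "(gam x (j + 1) * lag_sum k x p I) div (gam x i * gam x (i + 1)) * ?N =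
      ?e i * (gam x (Suc j) * lag_sum k x p I)"
    if "lo \<le> i" "i \<le> hi" "I \<subseteq> {1..k+1} - {i}" "Suc i \<in> I \<Longrightarrow> j = i" for i I
  proof -
    have "gam x i * gam x (i + 1) dvd gam x (Suc j) * lag_sum k x p I"
      using gam_mult_dvd_lag_sum[of i k I j x p] that assms by simp
    then obtain q where q: "gam x (Suc j) * lag_sum k x p I = gam x i * gam x (i + 1) * q"
      by (rule dvdE)
    then have "(gam x (j + 1) * lag_sum k x p I) div (gam x i * gam x (i + 1)) = q" by simp
    then show ?thesis
      unfolding q dual_fac_mult[OF that(1,2), symmetric] by (simp only: Suc_eq_plus1 mult_ac)
  qed
  have S: "(\<Sum>i=lo..j. Polynomial.smult (?a i)
        ((gam x (j + 1) * ?S) div (gam x i * gam x (i + 1)))) * ?N =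
      (\<Sum>i=lo..j. Polynomial.smult (?a i) (?e i)) * (gam x (Suc j) * ?S)"
    unfolding sum_distrib_right using assms by (intro sum.cong refl) (subst mult_smult_left, subst quot, auto)
  have T: "(\<Sum>i=j+1..hi. Polynomial.smult (?a i)
        ((gam x (j + 1) * ?T) div (gam x i * gam x (i + 1)))) * ?N =
      (\<Sum>i=j+1..hi. Polynomial.smult (?a i) (?e i)) * (gam x (Suc j) * ?T)"
    unfolding sum_distrib_right using assms by (intro sum.cong refl) (subst mult_smult_left, subst quot, auto)
  have "{lo..hi} = {lo..j} \<union> {j+1..hi}" using assms by auto
  then have one: "(\<Sum>i=lo..j. Polynomial.smult (?a i) (?e i)) +
      (\<Sum>i=j+1..hi. Polynomial.smult (?a i) (?e i)) = 1"
    using dual_coeff_sum[of lo hi x] assms by (simp add: sum.union_disjoint)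
  have split: "lag_sum k x p {1..k+1} = ?T + ?S"
    using lag_sum_split[of 0 j "k+1"] assms by simp
  \<comment> \<open>\<open>A\<close> and \<open>B\<close> are the two complementary partial sums,
    with total 1. Eliminating \<open>B\<close> leaves the lower Lagrange part \<open>t\<close> and
    the complete sum \<open>t + s\<close>.\<close>
  have alg: "- (A * (g * s)) + B * (g * t) = g * (t - A * (t + s))" if "A + B = 1"
    for A B g s t :: "complex poly"
  proof -
    have "B = 1 - A" using that by (metis add_diff_cancel_left')
    show ?thesis unfolding \<open>B = 1 - A\<close> by (simp add: algebra_simps)
  qed
  show ?thesis
    unfolding aux_entry_def distrib_right mult_minus_left S T split atLeastLessThanSuc_atLeastAtMost
    by (rule alg[OF one])
qed

text \<open>\<open>C\<close> stands for one entry of \<open>M D\<^sub>1\<^sup>T\<close> (or \<open>D\<^sub>2 M\<close>). Its first and last rows absorb the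
  nodes outside \<open>lo..hi\<close>, which accounts for the case distinction in the summation range.\<close>

lemma row_identity:
  assumes lo: "1 \<le> lo" "lo \<le> i" "i \<le> hi" "hi \<le> k" and inj: "inj_on x {lo..Suc hi}"
    and C: "C * gam_prod x lo (Suc hi) = gam x i * gam x (Suc i) *
      lag_sum k x p {if lo < i then i else 1..if i < hi then i else k + 1}"
  shows "C + ((if lo < i then gam x (Suc i) * aux_entry k x p lo hi (i - 1) else 0) -
      (if i < hi then gam x i * aux_entry k x p lo hi i else 0)) =
    Polynomial.smult (dual_coeff x lo hi i) (lag_sum k x p {1..k+1})"
proof -
  let ?N = "gam_prod x lo (Suc hi)" and ?P = "lag_sum k x p {1..k+1}" and ?g = "gam x i * gam x (Suc i)"
  let ?ae = "\<lambda>i. Polynomial.smult (dual_coeff x lo hi i) (dual_fac x lo hi i)"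
  define A where "A = (\<lambda>i. \<Sum>m=lo..<i. ?ae m)"
  \<comment> \<open>The values 0 below and \<open>?P\<close> above extend the product formula to the
    absent auxiliary terms: there the partial sum \<open>A\<close> is empty, respectively equal to
    1, and both sides vanish.\<close>
  define T1 where "T1 = (if lo < i then lag_sum k x p {1..i-1} else 0)"
  define T2 where "T2 = (if i < hi then lag_sum k x p {1..i} else ?P)"
  have prev: "(if lo < i then gam x (Suc i) * aux_entry k x p lo hi (i - 1) else 0) * ?N = ?g * (T1 - A i * ?P)"
  proof (cases "lo < i")
    case True
    then show ?thesis
      using aux_entry_mult[of lo "i - 1" hi k x p] assms
      by (simp add: T1_def A_def mult_ac)
  next
    case False
    with lo show ?thesis by (simp add: T1_def A_def)
  qed
  have "next": "(if i < hi then gam x i * aux_entry k x p lo hi i else 0) * ?N = ?g * (T2 - A (Suc i) * ?P)"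
  proof (cases "i < hi")
    case True
    then show ?thesis
      using aux_entry_mult[of lo i hi k x p] assms
      by (simp add: T2_def A_def mult_ac del: sum.op_ivl_Suc)
  next
    case False
    with lo have "i = hi" by simp
    then have "A (Suc i) = 1"
      using dual_coeff_sum[of lo hi x] assms by (simp add: A_def atLeastLessThanSuc_atLeastAtMost del: sum.op_ivl_Suc)
    then show ?thesis using False by (simp add: T2_def)
  qed
  have I: "lag_sum k x p {if lo < i then i else 1..if i < hi then i else k + 1} = T2 - T1"
    using lag_sum_split[of 0 "i - 1" i k x p] lag_sum_split[of 0 "i - 1" "k + 1" k x p] lo
    by (auto simp: T1_def T2_def)
  \<comment> \<open>The telescoping: the Lagrange parts cancel, and of the partial sums only the
    increment \<open>b\<close> survives.\<close>
  have alg: "g * (t - r) + (g * (r - a * q) - g * (t - (a + b) * q)) = g * (b * q)"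
    for g t r a b q :: "complex poly" by (simp add: algebra_simps)
  have A: "A (Suc i) = A i + ?ae i" using lo by (simp add: A_def)
  have "(C + ((if lo < i then gam x (Suc i) * aux_entry k x p lo hi (i - 1) else 0) -
      (if i < hi then gam x i * aux_entry k x p lo hi i else 0))) * ?N =
      ?g * (T2 - T1) + (?g * (T1 - A i * ?P) - ?g * (T2 - A (Suc i) * ?P))"
    unfolding distrib_right left_diff_distrib C prev "next" I ..
  also have "\<dots> = ?g * (?ae i * ?P)" unfolding A by (rule alg)
  also have "\<dots> = Polynomial.smult (dual_coeff x lo hi i) ?P * ?N"
    by (simp add: dual_fac_mult[OF lo(2,3), symmetric] mult_ac)
  finally show ?thesis by (simp only: mult_cancel_right) simp
qed

section \<open>Row and column sums of the upper left block\<close>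

text \<open>The corner block is the general one of the first block row with an additional summand for the
  node \<open>k + 1\<close>.\<close>

definition M_entry :: "nat \<Rightarrow> nat \<Rightarrow> (nat \<Rightarrow> complex) \<Rightarrow> (nat \<Rightarrow> complex) \<Rightarrow> nat \<Rightarrow> nat \<Rightarrow> complex poly" where
  "M_entry k \<mu> x p i j =
     (if i = \<mu> + 1 then Polynomial.smult (p j * wt k x j) (gam x (j + 1))
      else if j = \<mu> + 1 then Polynomial.smult (p i * wt k x i) (gam x (i + 1)) else 0) +
     (if i = \<mu> + 1 \<and> j = k then Polynomial.smult (p (k + 1) * wt k x (k + 1)) (gam x k) else 0)"

text \<open>The node ranges \<open>1..\<mu>+2\<close> and \<open>\<mu>+1..k+1\<close> cover all
  nodes and overlap exactly in \<open>\<mu>+1\<close> and \<open>\<mu>+2\<close>.\<close>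

lemma gam_prod_overlap:
  assumes "\<mu> < k"
  shows "gam_prod x 1 (Suc (Suc \<mu>)) * gam_prod x (Suc \<mu>) (Suc k) =
    gam x (Suc \<mu>) * gam x (Suc (Suc \<mu>)) * ell k x"
proof -
  have "{1..k+1} = {1..\<mu>} \<union> {Suc \<mu>..Suc k}" using assms by auto
  then have "ell k x = gam_prod x 1 \<mu> * gam_prod x (Suc \<mu>) (Suc k)"
    by (simp add: ell_def gam_prod_def prod.union_disjoint)
  then show ?thesis by (simp add: gam_prod_Suc mult_ac)
qed

text \<open>Provides the hypothesis on \<open>C\<close> of \<open>row_identity\<close> for the rows
  of the product of M with the transposed \<open>D1\<close>. Below the top row only block column
  \<open>\<mu>+1\<close> contributes, giving the single node \<open>i\<close>; the top row
  \<open>i = \<mu>+1\<close> collects the nodes \<open>\<mu>+1..k+1\<close>.\<close>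

lemma M_row:
  assumes "\<mu> < k" "1 \<le> i" "i \<le> \<mu> + 1"
  shows "(\<Sum>j=\<mu>+1..k. M_entry k \<mu> x p i j * dual_fac x (\<mu> + 1) k j) * gam_prod x 1 (Suc (\<mu> + 1)) =
    gam x i * gam x (Suc i) *
      lag_sum k x p {if 1 < i then i else 1..if i < \<mu> + 1 then i else k + 1}"
proof -
  let ?d = "dual_fac x (\<mu> + 1) k" and ?N = "gam_prod x 1 (Suc (\<mu> + 1))"
  let ?g = "gam x (Suc \<mu>) * gam x (Suc (Suc \<mu>))"
  have Nd: "?d j * ?N * (gam x j * gam x (Suc j)) = ?g * ell k x" if "j \<in> {\<mu>+1..k}" for j
  proof -
    have "?d j * ?N * (gam x j * gam x (Suc j)) = ?N * (?d j * (gam x j * gam x (Suc j)))"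
      by (simp only: mult_ac)
    also have "\<dots> = ?N * gam_prod x (Suc \<mu>) (Suc k)"
      using that dual_fac_mult[of "\<mu> + 1" j k x] by simp
    also have "\<dots> = ?g * ell k x"
      using gam_prod_overlap[OF assms(1), of x] by simp
    finally show ?thesis .
  qed
  have Nd0: "?d (\<mu> + 1) * ?N = ell k x"
    using Nd[of "\<mu> + 1"] assms(1) by (simp add: mult.commute)
  have Nd1: "gam x (Suc j) * (?d j * ?N) = ?g * (ell k x div gam x j)" if "j \<in> {\<mu>+1..k}" for j
    using that Nd[OF that] by (intro eq_ell_divI) (auto simp: mult_ac)
  \<comment> \<open>The additional corner summand carries \<open>gam x k\<close>, the other factor
    of the last consecutive pair, so it produces the node \<open>k + 1\<close>.\<close>
  have Nd2: "gam x k * (?d k * ?N) = ?g * (ell k x div gam x (k + 1))"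
    using assms(1) Nd[of k] by (intro eq_ell_divI) (auto simp: mult_ac)
  show ?thesis
  proof (cases "i = \<mu> + 1")
    case False
    then have "(\<Sum>j=\<mu>+1..k. M_entry k \<mu> x p i j * ?d j) =
        (\<Sum>j=\<mu>+1..k. if j = \<mu> + 1 then Polynomial.smult (p i * wt k x i) (gam x (i + 1)) * ?d j else 0)"
      using False by (intro sum.cong refl) (simp add: M_entry_def)
    also have "\<dots> = Polynomial.smult (p i * wt k x i) (gam x (i + 1)) * ?d (\<mu> + 1)"
      using assms(1) by simp
    finally have "(\<Sum>j=\<mu>+1..k. M_entry k \<mu> x p i j * ?d j) * ?N =
        Polynomial.smult (p i * wt k x i) (gam x (Suc i) * ell k x)"
      by (simp add: mult.assoc Nd0[simplified])
    moreover have "{if 1 < i then i else 1..if i < \<mu> + 1 then i else k + 1} = {i}"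
      using assms False by auto
    ultimately show ?thesis
      using assms by (simp add: lag_sum_def gam_mult_ell_div mult_ac)
  next
    case True
    have "(\<Sum>j=\<mu>+1..k. M_entry k \<mu> x p i j * ?d j) * ?N =
        (\<Sum>j=\<mu>+1..k. Polynomial.smult (p j * wt k x j) (gam x (Suc j) * (?d j * ?N)) +
           (if j = k then Polynomial.smult (p (k + 1) * wt k x (k + 1)) (gam x k * (?d j * ?N)) else 0))"
      unfolding sum_distrib_right
      by (intro sum.cong refl) (simp add: M_entry_def True distrib_right mult.assoc)
    also have "\<dots> = (\<Sum>j=\<mu>+1..k. Polynomial.smult (p j * wt k x j) (?g * (ell k x div gam x j))) +
        Polynomial.smult (p (k + 1) * wt k x (k + 1)) (?g * (ell k x div gam x (k + 1)))"
      unfolding sum.distrib using assms(1) Nd2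
      by (intro arg_cong2[of _ _ _ _ "(+)"] sum.cong refl) (simp_all only: Nd1, simp)
    also have "\<dots> = (\<Sum>j=\<mu>+1..k+1. Polynomial.smult (p j * wt k x j) (?g * (ell k x div gam x j)))"
      using assms(1) by simp
    also have "\<dots> = ?g * lag_sum k x p {\<mu>+1..k+1}"
      by (simp only: lag_sum_def sum_distrib_left mult_smult_right)
    also have "{\<mu>+1..k+1} = {if 1 < i then i else 1..if i < \<mu> + 1 then i else k + 1}"
      using True by auto
    finally show ?thesis by (simp add: True)
  qed
qed

text \<open>Counterpart of \<open>M_row\<close> for the columns of the product of \<open>D2\<close>
  with M: column \<open>\<mu>+1\<close> collects the nodes \<open>1..\<mu>+1\<close>, each further
  column contributes its own node, and column \<open>k\<close> also the node
  \<open>k + 1\<close>.\<close>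

lemma M_col:
  assumes "\<mu> < k" "\<mu> + 1 \<le> j" "j \<le> k"
  shows "(\<Sum>i=1..\<mu>+1. M_entry k \<mu> x p i j * dual_fac x 1 (\<mu> + 1) i) * gam_prod x (\<mu> + 1) (Suc k) =
    gam x j * gam x (Suc j) *
      lag_sum k x p {if \<mu> + 1 < j then j else 1..if j < k then j else k + 1}"
proof -
  let ?e = "dual_fac x 1 (\<mu> + 1)" and ?N = "gam_prod x (\<mu> + 1) (Suc k)"
  let ?g = "gam x (Suc \<mu>) * gam x (Suc (Suc \<mu>))" and ?gj = "gam x j * gam x (Suc j)"
  let ?c = "if j = k then Polynomial.smult (p (k + 1) * wt k x (k + 1)) (gam x k) else 0"
  have Ne: "?e i * ?N * (gam x i * gam x (Suc i)) = ?g * ell k x" if "i \<in> {1..\<mu>+1}" for i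
  proof -
    have "?e i * ?N * (gam x i * gam x (Suc i)) = ?e i * (gam x i * gam x (Suc i)) * ?N"
      by (simp only: mult_ac)
    also have "\<dots> = gam_prod x 1 (Suc (Suc \<mu>)) * ?N"
      using that dual_fac_mult[of 1 i "\<mu> + 1" x] by simp
    also have "\<dots> = ?g * ell k x"
      using gam_prod_overlap[OF assms(1), of x] by simp
    finally show ?thesis .
  qed
  have Ne0: "?e (\<mu> + 1) * ?N = ell k x"
    using Ne[of "\<mu> + 1"] by (simp add: mult.commute)
  have Ne1: "gam x (Suc i) * (?e i * ?N) = ?g * (ell k x div gam x i)" if "i \<in> {1..\<mu>+1}" for i
    using that Ne[OF that] assms(1) by (intro eq_ell_divI) (auto simp: mult_ac)
  \<comment> \<open>The additional corner summand is split off first, since for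
    \<open>\<mu> = k - 1\<close> the column \<open>k\<close> is at the same time the column
    \<open>\<mu>+1\<close>.\<close>
  have corner: "?c * ell k x = ?gj * lag_sum k x p (if j = k then {k+1} else {})"
    using ell_div_gam_mult[of "k + 1" k x] by (simp add: lag_sum_def mult_ac)
  have sets: "lag_sum k x p {if \<mu> + 1 < j then j else 1..if j < k then j else k + 1} =
      lag_sum k x p {if \<mu> + 1 < j then j else 1..j} + lag_sum k x p (if j = k then {k+1} else {})"
    using assms by (auto simp: lag_sum_def)
  have "(\<Sum>i=1..\<mu>+1. M_entry k \<mu> x p i j * ?e i) * ?N =
      (\<Sum>i=1..\<mu>+1. (if i = \<mu> + 1 then Polynomial.smult (p j * wt k x j) (gam x (j + 1))
         else if j = \<mu> + 1 then Polynomial.smult (p i * wt k x i) (gam x (i + 1)) else 0) * (?e i * ?N) +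
        (if i = \<mu> + 1 then ?c * (?e i * ?N) else 0))"
    unfolding sum_distrib_right
    by (intro sum.cong refl) (simp add: M_entry_def distrib_right mult.assoc)
  also have "\<dots> = (\<Sum>i=1..\<mu>+1. (if i = \<mu> + 1 then Polynomial.smult (p j * wt k x j) (gam x (j + 1))
         else if j = \<mu> + 1 then Polynomial.smult (p i * wt k x i) (gam x (i + 1)) else 0) * (?e i * ?N)) +
      ?c * ell k x"
    by (simp add: sum.distrib Ne0[simplified])
  also have "(\<Sum>i=1..\<mu>+1. (if i = \<mu> + 1 then Polynomial.smult (p j * wt k x j) (gam x (j + 1))
         else if j = \<mu> + 1 then Polynomial.smult (p i * wt k x i) (gam x (i + 1)) else 0) * (?e i * ?N)) =
      ?gj * lag_sum k x p {if \<mu> + 1 < j then j else 1..j}" (is "?lhs = _")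
  proof (cases "j = \<mu> + 1")
    case True
    have "?lhs = (\<Sum>i=1..\<mu>+1. Polynomial.smult (p i * wt k x i) (gam x (Suc i) * (?e i * ?N)))"
      by (intro sum.cong refl) (simp add: True)
    also have "\<dots> = (\<Sum>i=1..\<mu>+1. Polynomial.smult (p i * wt k x i) (?g * (ell k x div gam x i)))"
      by (intro sum.cong refl) (simp only: Ne1)
    finally show ?thesis
      by (simp add: True lag_sum_def distrib_left sum_distrib_left)
  next
    case False
    have "?lhs = (\<Sum>i=1..\<mu>+1. if i = \<mu> + 1 then
        Polynomial.smult (p j * wt k x j) (gam x (j + 1)) * (?e i * ?N) else 0)"
      using False by (intro sum.cong refl) simp
    also have "\<dots> = Polynomial.smult (p j * wt k x j) (gam x (Suc j) * ell k x)"
      by (simp add: Ne0[simplified])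
    finally show ?thesis
      using False assms by (simp add: lag_sum_def gam_mult_ell_div mult_ac)
  qed
  finally show ?thesis unfolding sets corner distrib_left .
qed

section \<open>Eigenvectors of the linearization\<close>

lemma eval_four_block_mat:
  assumes "A \<in> carrier_mat r1 c1" "B \<in> carrier_mat r1 c2" "C \<in> carrier_mat r2 c1" "D \<in> carrier_mat r2 c2"
  shows "eval_mat (four_block_mat A B C D) z =
    four_block_mat (eval_mat A z) (eval_mat B z) (eval_mat C z) (eval_mat D z)"
  using assms by (intro eq_matI) (auto simp: eval_mat_def)

lemma eval_transpose_mat: "eval_mat (transpose_mat A) z = transpose_mat (eval_mat A z)"
  by (rule eq_matI) (auto simp: eval_mat_def)

lemma eval_zero_mat: "eval_mat (0\<^sub>m r c) z = 0\<^sub>m r c"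
  by (rule eq_matI) (auto simp: eval_mat_def)

text \<open>Left eigenvectors become kernel vectors of the transpose, to which
  \<open>pencil_kernel\<close> applies.\<close>

lemma mat_of_row_mult_eq_0_iff:
  fixes A :: "'a :: comm_semiring_0 mat"
  assumes "A \<in> carrier_mat r c" "v \<in> carrier_vec r"
  shows "mat_of_row v * A = 0\<^sub>m 1 c \<longleftrightarrow> transpose_mat A *\<^sub>v v = 0\<^sub>v c"
proof -
  have "(mat_of_row v * A) $$ (0, j) = (transpose_mat A *\<^sub>v v) $ j" if "j < c" for j
    using that assms by (simp add: comm_scalar_prod[of _ r])
  then show ?thesis
    using assms by (auto simp: mat_eq_iff vec_eq_iff simp del: index_mult_mat(1) index_mult_mat_vec)
qed

lemma poly_if_0: "poly (if c then q else 0) z = (if c then poly q z else 0)"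
  by simp

lemma lagrange_sum_entry:
  "s < n \<Longrightarrow> t < n \<Longrightarrow> lagrange_sum n k x P I $$ (s, t) = lag_sum k x (\<lambda>i. P i $$ (s, t)) I"
  by (simp add: lagrange_sum_def lag_sum_def)

lemma lagrange_sum_carrier: "lagrange_sum n k x P I \<in> carrier_mat n n"
  by (simp add: lagrange_sum_def)

lemma aux_poly_entry:
  assumes "s < n" "t < n"
  shows "aux_poly n k x P (dual_coeff x lo hi) lo hi j $$ (s, t) =
    aux_entry k x (\<lambda>i. P i $$ (s, t)) lo hi j"
  using assms by (simp add: aux_poly_def aux_entry_def S_poly_def T_poly_def lagrange_sum_entry)

lemma lagrange_poly_dmat:
  "lagrange_poly n k x P = dmat n 0 1 0 1 (\<lambda>_ _ s t. lag_sum k x (\<lambda>i. P i $$ (s, t)) {1..k+1})"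
  by (rule eq_matI)
    (auto simp: lagrange_poly_def dmat_def lagrange_sum_entry carrier_matD[OF lagrange_sum_carrier])

text \<open>Translation from block positions counted from the top left corner to node indices, by
  \<open>i = \<mu> + 1 - r\<close> and \<open>j = k - c\<close>.\<close>

lemma M_pencil_dmat:
  assumes "\<mu> < k" and P: "\<And>i. i \<in> {1..k+1} \<Longrightarrow> P i \<in> carrier_mat n n"
  shows "M_pencil n k \<mu> x P = dmat n 1 (Suc (\<mu> + 1)) (\<mu> + 1) (Suc k)
    (\<lambda>i j s t. M_entry k \<mu> x (\<lambda>l. P l $$ (s, t)) i j)"
proof -
  let ?B = "\<lambda>i g. Polynomial.smult (wt k x i) (gam x g) \<cdot>\<^sub>m const_mat (P i)"
  have B: "?B i g $$ (s, t) = Polynomial.smult (P i $$ (s, t) * wt k x i) (gam x g)"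
    if "i \<in> {1..k+1}" "s < n" "t < n" for i g s t
    using P[OF that(1)] that by (simp add: const_mat_def mult.commute)
  have dim_B: "dim_row (?B i g) = n" "dim_col (?B i g) = n" if "i \<in> {1..k+1}" for i g
    using P[OF that] by (simp_all add: const_mat_def)
  define f where "f = (\<lambda>r c. if r = 0 \<and> c = 0 then ?B (k + 1) k + ?B k (k + 1)
    else if r = 0 then ?B (k - c) (k - c + 1)
    else if c = k - \<mu> - 1 then ?B (\<mu> + 1 - r) (\<mu> + 2 - r) else 0\<^sub>m n n)"
  have "M_pencil n k \<mu> x P = block_mat n (Suc (\<mu> + 1) - 1) (Suc k - (\<mu> + 1)) f"
    by (simp add: M_pencil_def f_def Let_def)
  also have "\<dots> = dmat n 1 (Suc (\<mu> + 1)) (\<mu> + 1) (Suc k)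
      (\<lambda>i j s t. M_entry k \<mu> x (\<lambda>l. P l $$ (s, t)) i j)"
    unfolding block_mat_dmat
  proof (rule dmat_cong)
    fix i j s t
    assume ij: "i \<in> {1..<Suc (\<mu> + 1)}" "j \<in> {\<mu> + 1..<Suc k}" and st: "s < n" "t < n"
    define r c where "r = Suc (\<mu> + 1) - 1 - i" and "c = Suc k - 1 - j"
    have rc: "r = 0 \<longleftrightarrow> i = \<mu> + 1" "c = 0 \<longleftrightarrow> j = k" "c = k - \<mu> - 1 \<longleftrightarrow> j = \<mu> + 1"
      "k - c = j" "\<mu> + 1 - r = i" "\<mu> + 2 - r = i + 1"
      using ij by (auto simp: r_def c_def)
    have "f r c $$ (s, t) = M_entry k \<mu> x (\<lambda>l. P l $$ (s, t)) i j"
    proof (cases "i = \<mu> + 1 \<and> j = k")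
      case True
      have "(?B (k + 1) k + ?B k (k + 1)) $$ (s, t) = ?B (k + 1) k $$ (s, t) + ?B k (k + 1) $$ (s, t)"
        using st dim_B[of k "k + 1"] assms(1) by (intro index_add_mat(1)) auto
      with True st assms(1) show ?thesis
        unfolding f_def rc M_entry_def by (simp add: B del: index_smult_mat)
    next
      case False
      with ij st show ?thesis
        unfolding f_def rc M_entry_def by (auto simp: B simp del: index_smult_mat)
    qed
    then show "f (Suc (\<mu> + 1) - 1 - i) (Suc k - 1 - j) $$ (s, t) =
        M_entry k \<mu> x (\<lambda>l. P l $$ (s, t)) i j"
      by (simp only: r_def c_def)
  qed
  finally show ?thesis .
qed

text \<open>The sizes and shifts are variables tied by equations, so that the statement matches the
  differently written \<open>K1\<close> and \<open>K2\<close>.\<close>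

lemma eval_bidiag_block_mat:
  assumes sizes: "R = hi - lo" "C = Suc hi - lo" "m = Suc hi" "l = hi - 1"
  shows "eval_mat (block_mat n R C (\<lambda>r c.
     if c = r then gam x (m - r) \<cdot>\<^sub>m 1\<^sub>m n
     else if c = r + 1 then (- gam x (l - r)) \<cdot>\<^sub>m 1\<^sub>m n
     else 0\<^sub>m n n)) z = bidiag_mat n lo hi x z"
  unfolding sizes block_mat_dmat eval_dmat bidiag_mat_def
proof (rule dmat_cong)
  fix i j s t
  assume ij: "i \<in> {lo..<hi}" "j \<in> {lo..<Suc hi}" and st: "s < n" "t < n"
  define r c where "r = hi - 1 - i" and "c = Suc hi - 1 - j"
  have rc: "c = r \<longleftrightarrow> j = Suc i" "c = r + 1 \<longleftrightarrow> j = i" "Suc hi - r = Suc (Suc i)" "hi - 1 - r = i"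
    using ij by (auto simp: r_def c_def)
  show "poly ((if Suc hi - 1 - j = hi - 1 - i then gam x (Suc hi - (hi - 1 - i)) \<cdot>\<^sub>m 1\<^sub>m n
       else if Suc hi - 1 - j = hi - 1 - i + 1 then (- gam x (hi - 1 - (hi - 1 - i))) \<cdot>\<^sub>m 1\<^sub>m n
       else 0\<^sub>m n n) $$ (s, t)) z =
     (if s = t then if j = Suc i then z - x (Suc (Suc i)) else if j = i then x i - z else 0 else 0)"
    unfolding r_def[symmetric] c_def[symmetric] rc using st by simp
qed

lemma eval_dual_block_mat:
  "transpose_mat (eval_mat (block_mat n 1 (Suc hi - lo) (\<lambda>_ c. dual_fac x lo hi (hi - c) \<cdot>\<^sub>m 1\<^sub>m n)) z) =
    dual_mat n lo hi x z"
  using block_mat_dmat[of n 1 0 "Suc hi" lo "\<lambda>_ c. dual_fac x lo hi (hi - c) \<cdot>\<^sub>m 1\<^sub>m n"]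
  by (auto simp: eval_dmat transpose_dmat dual_mat_def intro!: dmat_cong)

lemma eval_L_pencil:
  assumes "\<mu> < k" and P: "\<And>i. i \<in> {1..k+1} \<Longrightarrow> P i \<in> carrier_mat n n"
  shows "eval_mat (L_pencil n k \<mu> x P) z = four_block_mat
    (dmat n 1 (Suc (\<mu> + 1)) (\<mu> + 1) (Suc k) (\<lambda>i j s t. poly (M_entry k \<mu> x (\<lambda>l. P l $$ (s, t)) i j) z))
    (transpose_mat (bidiag_mat n 1 (\<mu> + 1) x z)) (bidiag_mat n (\<mu> + 1) k x z)
    (0\<^sub>m ((k - (\<mu> + 1)) * n) ((\<mu> + 1 - 1) * n))"
proof -
  have K1: "eval_mat (K1 n k \<mu> x) z = bidiag_mat n (\<mu> + 1) k x z"
    unfolding K1_def by (rule eval_bidiag_block_mat) (use assms(1) in auto)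
  have K2: "eval_mat (K2 n \<mu> x) z = bidiag_mat n 1 (\<mu> + 1) x z"
    unfolding K2_def by (rule eval_bidiag_block_mat) auto
  have "eval_mat (L_pencil n k \<mu> x P) z = four_block_mat (eval_mat (M_pencil n k \<mu> x P) z)
      (eval_mat (transpose_mat (K2 n \<mu> x)) z) (eval_mat (K1 n k \<mu> x) z)
      (eval_mat (0\<^sub>m ((k - \<mu> - 1) * n) (\<mu> * n)) z)"
    unfolding L_pencil_def
    by (rule eval_four_block_mat[of _ "(\<mu> + 1) * n" "(k - \<mu>) * n" _ "\<mu> * n" _ "(k - \<mu> - 1) * n"])
      (simp_all add: M_pencil_def K1_def K2_def block_mat_def)
  moreover have "eval_mat (M_pencil n k \<mu> x P) z = dmat n 1 (Suc (\<mu> + 1)) (\<mu> + 1) (Suc k)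
      (\<lambda>i j s t. poly (M_entry k \<mu> x (\<lambda>l. P l $$ (s, t)) i j) z)"
    by (simp only: M_pencil_dmat[OF assms] eval_dmat)
  ultimately show ?thesis
    by (simp add: eval_transpose_mat eval_zero_mat K1 K2)
qed

lemma eval_H_mat:
  "eval_mat (H_mat n k \<mu> x P) z = dual_mat n (\<mu> + 1) k x z @\<^sub>r
    dmat n 1 (\<mu> + 1) 0 1 (\<lambda>i _ s t. poly (aux_entry k x (\<lambda>l. P l $$ (s, t)) 1 (\<mu> + 1) i) z)"
proof -
  have "eval_mat (transpose_mat (D1 n k \<mu> x)) z = dual_mat n (\<mu> + 1) k x z"
    using eval_dual_block_mat[of n k "\<mu> + 1" x z] by (simp add: D1_def eval_transpose_mat)
  moreover have "block_mat n \<mu> 1 (\<lambda>r _. P_aux n k \<mu> x P (\<mu> - r)) =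
      dmat n 1 (\<mu> + 1) 0 1 (\<lambda>i _ s t. aux_entry k x (\<lambda>l. P l $$ (s, t)) 1 (\<mu> + 1) i)"
    using block_mat_dmat[of n "\<mu> + 1" 1 1 0 "\<lambda>r _. P_aux n k \<mu> x P (\<mu> - r)"]
    by (auto simp: P_aux_def a_coeff_def aux_poly_entry intro!: dmat_cong)
  \<comment> \<open>\<open>@\<^sub>r\<close> is a four-block matrix whose right blocks have width
    zero.\<close>
  moreover have append: "eval_mat (A @\<^sub>r B) z = eval_mat A z @\<^sub>r eval_mat B z"
    if "A \<in> carrier_mat a n" "B \<in> carrier_mat b n" for A B a b
    using that eval_four_block_mat[of A a n "0\<^sub>m a 0" 0 B b "0\<^sub>m b 0" z]
    by (simp add: append_rows_def eval_zero_mat) (simp add: eval_mat_def)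
  moreover have "eval_mat (H_mat n k \<mu> x P) z = eval_mat (transpose_mat (D1 n k \<mu> x)) z @\<^sub>r
      eval_mat (block_mat n \<mu> 1 (\<lambda>r _. P_aux n k \<mu> x P (\<mu> - r))) z"
    unfolding H_mat_def
    by (rule append[of _ "(k - \<mu>) * n" _ "\<mu> * n"]) (simp_all add: D1_def block_mat_def)
  ultimately show ?thesis by (simp only: eval_dmat)
qed

text \<open>Transposition gives the stacked form required by \<open>pencil_kernel\<close>; the
  entries of the coefficient matrices change to position \<open>(t, s)\<close>.\<close>

lemma transpose_eval_G_mat:
  "transpose_mat (eval_mat (G_mat n k \<mu> x P) z) = dual_mat n 1 (\<mu> + 1) x z @\<^sub>r
    dmat n (\<mu> + 1) k 0 1 (\<lambda>i _ s t. poly (aux_entry k x (\<lambda>l. P l $$ (t, s)) (\<mu> + 1) k i) z)"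
proof -
  let ?Q = "block_mat n 1 (k - \<mu> - 1) (\<lambda>_ c. Q_aux n k \<mu> x P (k - 1 - c))"
  have D2: "transpose_mat (eval_mat (D2 n \<mu> x) z) = dual_mat n 1 (\<mu> + 1) x z"
    using eval_dual_block_mat[of n "\<mu> + 1" 1 x z] by (simp add: D2_def)
  have "?Q = dmat n 0 1 (\<mu> + 1) k (\<lambda>_ j s t. aux_entry k x (\<lambda>l. P l $$ (s, t)) (\<mu> + 1) k j)"
    using block_mat_dmat[of n 1 0 k "\<mu> + 1" "\<lambda>_ c. Q_aux n k \<mu> x P (k - 1 - c)"]
    by (auto simp: Q_aux_def b_coeff_def aux_poly_entry intro!: dmat_cong)
  then have Q: "transpose_mat (eval_mat ?Q z) =
      dmat n (\<mu> + 1) k 0 1 (\<lambda>i _ s t. poly (aux_entry k x (\<lambda>l. P l $$ (t, s)) (\<mu> + 1) k i) z)"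
    by (simp add: eval_dmat transpose_dmat)
  have carr: "D2 n \<mu> x \<in> carrier_mat n ((\<mu> + 1) * n)" "?Q \<in> carrier_mat n ((k - \<mu> - 1) * n)"
    by (simp_all add: D2_def block_mat_def)
  have carr': "eval_mat (D2 n \<mu> x) z \<in> carrier_mat n ((\<mu> + 1) * n)"
    "eval_mat ?Q z \<in> carrier_mat n ((k - \<mu> - 1) * n)"
    using carr by (simp_all add: eval_mat_def)
  have "eval_mat (G_mat n k \<mu> x P) z = four_block_mat (eval_mat (D2 n \<mu> x) z) (eval_mat ?Q z)
      (0\<^sub>m 0 ((\<mu> + 1) * n)) (0\<^sub>m 0 ((k - \<mu> - 1) * n))"
    unfolding G_mat_def
    by (subst eval_four_block_mat[OF carr zero_carrier_mat zero_carrier_mat]) (simp only: eval_zero_mat)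
  also have "transpose_mat \<dots> =
      transpose_mat (eval_mat (D2 n \<mu> x) z) @\<^sub>r transpose_mat (eval_mat ?Q z)"
    using carr' by (subst transpose_four_block_mat[OF carr' zero_carrier_mat zero_carrier_mat])
      (simp add: append_rows_def)
  finally show ?thesis by (simp only: D2 Q)
qed

theorem theorem4p8:
  fixes n k \<mu> :: nat
    and x :: "nat \<Rightarrow> complex"
    and P :: "nat \<Rightarrow> complex mat"
    and lambda0 :: complex
  assumes "n \<ge> 1"
    and "k \<ge> 1"
    and "\<mu> \<le> k - 1"
    and "inj_on x {1..k+1}"
    and "\<And>i. i \<in> {1..k+1} \<Longrightarrow> P i \<in> carrier_mat n n"
    and "regular_mat_poly (lagrange_poly n k x P)"
    and "finite_eigenvalue (lagrange_poly n k x P) lambda0"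
  shows "(\<forall>z. right_eigenvector (L_pencil n k \<mu> x P) lambda0 z \<longleftrightarrow>
            (\<exists>u. right_eigenvector (lagrange_poly n k x P) lambda0 u \<and>
                 z = eval_mat (H_mat n k \<mu> x P) lambda0 *\<^sub>v u)) \<and>
         (\<forall>w. left_eigenvector (L_pencil n k \<mu> x P) lambda0 w \<longleftrightarrow>
            (\<exists>y. left_eigenvector (lagrange_poly n k x P) lambda0 y \<and>
                 w = transpose_mat (eval_mat (G_mat n k \<mu> x P) lambda0) *\<^sub>v y))"
proof -
  let ?L = "L_pencil n k \<mu> x P" and ?P = "lagrange_poly n k x P"
  let ?p = "\<lambda>s t l. P l $$ (s, t)"
  let ?M = "\<lambda>i j s t. poly (M_entry k \<mu> x (?p s t) i j) lambda0"
  have mu: "\<mu> < k" using assms(2,3) by simp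
  have inj1: "inj_on x {\<mu> + 1..Suc k}" and inj2: "inj_on x {1..Suc (\<mu> + 1)}"
    using mu by (auto intro: inj_on_subset[OF assms(4)])
  have L: "eval_mat ?L lambda0 = four_block_mat (dmat n 1 (Suc (\<mu> + 1)) (\<mu> + 1) (Suc k) ?M)
      (transpose_mat (bidiag_mat n 1 (\<mu> + 1) x lambda0)) (bidiag_mat n (\<mu> + 1) k x lambda0)
      (0\<^sub>m ((k - (\<mu> + 1)) * n) ((\<mu> + 1 - 1) * n))"
    using mu assms(5) by (rule eval_L_pencil)
  have dim_L: "?L \<in> carrier_mat ((Suc (\<mu> + 1) - 1) * n + (k - (\<mu> + 1)) * n)
      ((Suc k - (\<mu> + 1)) * n + (\<mu> + 1 - 1) * n)"
    by (simp add: L_pencil_def M_pencil_def block_mat_def)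
  then have dim_eL: "eval_mat ?L lambda0 \<in> carrier_mat ((Suc (\<mu> + 1) - 1) * n + (k - (\<mu> + 1)) * n)
      ((Suc k - (\<mu> + 1)) * n + (\<mu> + 1 - 1) * n)"
    by (simp add: eval_mat_def)
  have dim_P: "?P \<in> carrier_mat n n" by (simp add: lagrange_poly_dmat dmat_def)
  then have dim_eP: "eval_mat ?P lambda0 \<in> carrier_mat n n" by (simp add: eval_mat_def)
  have left: "left_eigenvector A lambda0 v \<longleftrightarrow> v \<in> carrier_vec r \<and> v \<noteq> 0\<^sub>v r \<and>
      transpose_mat (eval_mat A lambda0) *\<^sub>v v = 0\<^sub>v c"
    if "A \<in> carrier_mat r c" for A r c v
  proof -
    from that have "eval_mat A lambda0 \<in> carrier_mat r c" by (simp add: eval_mat_def)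
    then show ?thesis
      using that mat_of_row_mult_eq_0_iff[of "eval_mat A lambda0" r c v]
      by (auto simp: left_eigenvector_def)
  qed
  have mu': "\<mu> + 1 \<le> k" and one_le: "1 \<le> \<mu> + 1" using mu by simp_all
  \<comment> \<open>Hypothesis \<open>rows\<close> for right eigenvectors:
    \<open>row_identity\<close> with range \<open>1..\<mu>+1\<close>, fed by \<open>M_row\<close>,
    as a polynomial identity evaluated at \<open>lambda0\<close>.\<close>
  have row: "(\<Sum>j=\<mu>+1..k. ?M i j s t * poly (dual_fac x (\<mu> + 1) k j) lambda0) +
      ((if 1 < i then (lambda0 - x (Suc i)) * poly (aux_entry k x (?p s t) 1 (\<mu> + 1) (i - 1)) lambda0 else 0) -
       (if i < \<mu> + 1 then (lambda0 - x i) * poly (aux_entry k x (?p s t) 1 (\<mu> + 1) i) lambda0 else 0)) =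
      dual_coeff x 1 (\<mu> + 1) i * poly (lag_sum k x (?p s t) {1..k+1}) lambda0"
    if "1 \<le> i" "i \<le> \<mu> + 1" for i s t
    using arg_cong[where f = "\<lambda>q. poly q lambda0",
        OF row_identity[OF le_refl that mu' inj2 M_row[OF mu that, where p = "?p s t"]]]
    by (simp only: poly_add poly_diff poly_mult poly_smult poly_sum poly_gam poly_if_0)
  \<comment> \<open>The analogue for left eigenvectors, with range \<open>\<mu>+1..k\<close>, fed by
    \<open>M_col\<close>; the matrix positions are swapped because the transposed pencil is
    treated.\<close>
  have col: "(\<Sum>i=1..\<mu>+1. ?M i j t s * poly (dual_fac x 1 (\<mu> + 1) i) lambda0) +
      ((if \<mu> + 1 < j then (lambda0 - x (Suc j)) * poly (aux_entry k x (?p t s) (\<mu> + 1) k (j - 1)) lambda0 else 0) -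
       (if j < k then (lambda0 - x j) * poly (aux_entry k x (?p t s) (\<mu> + 1) k j) lambda0 else 0)) =
      dual_coeff x (\<mu> + 1) k j * poly (lag_sum k x (?p t s) {1..k+1}) lambda0"
    if "\<mu> + 1 \<le> j" "j \<le> k" for j s t
    using arg_cong[where f = "\<lambda>q. poly q lambda0",
        OF row_identity[OF one_le that le_refl inj1 M_col[OF mu that, where p = "?p t s"]]]
    by (simp only: poly_add poly_diff poly_mult poly_smult poly_sum poly_gam poly_if_0)
  have "right_eigenvector ?L lambda0 z \<longleftrightarrow>
      (\<exists>u. right_eigenvector ?P lambda0 u \<and> z = eval_mat (H_mat n k \<mu> x P) lambda0 *\<^sub>v u)" for z
  proof -
    have "right_eigenvector ?L lambda0 z \<longleftrightarrow> z \<in> carrier_vec ((Suc k - (\<mu> + 1)) * n + (\<mu> + 1 - 1) * n) \<and>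
      z \<noteq> 0\<^sub>v ((Suc k - (\<mu> + 1)) * n + (\<mu> + 1 - 1) * n) \<and>
      eval_mat ?L lambda0 *\<^sub>v z = 0\<^sub>v ((Suc (\<mu> + 1) - 1) * n + (k - (\<mu> + 1)) * n)"
      unfolding right_eigenvector_def carrier_matD[OF dim_L] ..
    also have "\<dots> \<longleftrightarrow> (\<exists>u. u \<in> carrier_vec n \<and> u \<noteq> 0\<^sub>v n \<and> eval_mat ?P lambda0 *\<^sub>v u = 0\<^sub>v n \<and>
        z = eval_mat (H_mat n k \<mu> x P) lambda0 *\<^sub>v u)"
      unfolding L eval_H_mat lagrange_poly_dmat eval_dmat
      by (rule pencil_kernel) (use mu inj1 inj2 row in auto)
    also have "\<dots> \<longleftrightarrow> (\<exists>u. right_eigenvector ?P lambda0 u \<and> z = eval_mat (H_mat n k \<mu> x P) lambda0 *\<^sub>v u)"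
      unfolding right_eigenvector_def carrier_matD[OF dim_P] by blast
    finally show ?thesis .
  qed
  moreover have "left_eigenvector ?L lambda0 w \<longleftrightarrow>
      (\<exists>y. left_eigenvector ?P lambda0 y \<and> w = transpose_mat (eval_mat (G_mat n k \<mu> x P) lambda0) *\<^sub>v y)" for w
  proof -
    \<comment> \<open>The transpose has the shape of the pencil again, with the two bidiagonal
      blocks and thus the two index ranges exchanged.\<close>
    have LT: "transpose_mat (eval_mat ?L lambda0) = four_block_mat
        (dmat n (\<mu> + 1) (Suc k) 1 (Suc (\<mu> + 1)) (\<lambda>i j s t. ?M j i t s))
        (transpose_mat (bidiag_mat n (\<mu> + 1) k x lambda0)) (bidiag_mat n 1 (\<mu> + 1) x lambda0)
        (0\<^sub>m ((\<mu> + 1 - 1) * n) ((k - (\<mu> + 1)) * n))"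
      unfolding L
      by (subst transpose_four_block_mat[OF dmat_carrier
            transpose_carrier_mat[THEN iffD2, OF bidiag_carrier] bidiag_carrier zero_carrier_mat])
        (simp only: transpose_dmat transpose_transpose zero_transpose_mat)
    have PT: "transpose_mat (eval_mat ?P lambda0) =
        dmat n 0 1 0 1 (\<lambda>_ _ s t. poly (lag_sum k x (?p t s) {1..k+1}) lambda0)"
      by (simp only: lagrange_poly_dmat eval_dmat transpose_dmat)
    show ?thesis
      unfolding left[OF dim_L] left[OF dim_P] LT transpose_eval_G_mat PT
      unfolding conj_assoc
      by (rule pencil_kernel) (use mu inj1 inj2 col in auto)
  qed
  ultimately show ?thesis by blast
qed

end
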